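(* Let $P,Q\in L_1(0,\pi)$ be complex-valued, and let $\mathbb{L}$ and $\mathbb{L}^*$ be the maximal Dirac operators $\mathbb{L}\mathbf{y}=B\mathbf{y}'+V\mathbf{y}$ and $\mathbb{L}^*\mathbf{z}=B\mathbf{z}'+V^*\mathbf{z}$ in $\mathbb{H}=L_2(0,\pi)\oplus L_2(0,\pi)$ (defined in the context). Suppose that the following conditions hold: 1) $\{\mathbf{y}_n\}_{n\in\mathbb{N}}$ is an arbitrary system which is complete and minimal in $\mathbb{H}$ and consists of eigenfunctions and associated functions of $\mathbb{L}$, where $\lambda_n\in\mathbb{C}$ is the eigenvalue corresponding to $\mathbf{y}_n$; 2) the biorthogonally adjoint system $\{\mathbf{z}_n\}_{n\in\mathbb{N}}$, i.e. $\langle\mathbf{y}_n,\mathbf{z}_k\rangle=\delta_{n,k}$ for all $n,k\in\mathbb{N}$, consists of eigenfunctions and associated functions of $\mathbb{L}^*$, where $\overline{\lambda_n}$ is the eigenvalue corresponding to $\mathbf{z}_n$; 3) the systems $\{\mathbf{y}_n\}$ and $\{\mathbf{z}_n\}$ contain only a finite number of associated functions (that is, for all but finitely many $n$ both $\mathbf{y}_n$ and $\mathbf{z}_n$ are eigenfunctions); 4) $\limsup_{n\to\infty}|\mathrm{Im}\,\lambda_n|=\infty$. Then the system $\{\mathbf{y}_n\}$ is not a basis in $\mathbb{H}$.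
   Context: $\mathbb{H}=L_2(0,\pi)\oplus L_2(0,\pi)$ is the complex Hilbert space of vector functions $\mathbf{f}=\mathrm{col}(f_1(x),f_2(x))$ with inner product $\langle\mathbf{f},\mathbf{g}\rangle=\int_0^\pi\left(f_1(x)\overline{g_1(x)}+f_2(x)\overline{g_2(x)}\right)dx$. Set $$B=\begin{pmatrix}-i&0\\0&i\end{pmatrix},\quad V(x)=\begin{pmatrix}0&P(x)\\Q(x)&0\end{pmatrix},\quad V^*(x)=\begin{pmatrix}0&\overline{Q(x)}\\\overline{P(x)}&0\end{pmatrix}.$$ $W_1^1[0,\pi]$ denotes the Sobolev space of absolutely continuous complex-valued functions on $[0,\pi]$ (with derivative in $L_1(0,\pi)$). The maximal operator $\mathbb{L}$ is $\mathbb{L}\mathbf{y}=B\mathbf{y}'+V\mathbf{y}$ with domain $D(\mathbb{L})=\{\mathbf{y}\in W_1^1[0,\pi]\oplus W_1^1[0,\pi]:\ \mathbb{L}\mathbf{y}\in\mathbb{H}\}$. No boundary conditions are imposed. The formally adjoint operator is $\mathbb{L}^*\mathbf{z}=B\mathbf{z}'+V^*\mathbf{z}$, with domain defined in the same way: $D(\mathbb{L}^* )=\{\mathbf{z}\in W_1^1[0,\pi]\oplus W_1^1[0,\pi]:\ \mathbb{L}^*\mathbf{z}\in\mathbb{H}\}$. Root functions are understood irrespective of boundary conditions. An eigenfunction of $\mathbb{L}$ corresponding to a complex eigenvalue $\lambda$ is any function $\overset{0}{\mathbf{y}}\in D(\mathbb{L})$, $\overset{0}{\mathbf{y}}\not\equiv0$,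 satisfying $\mathbb{L}\overset{0}{\mathbf{y}}=\lambda\overset{0}{\mathbf{y}}$ almost everywhere on $(0,\pi)$. An associated function of order $l=1,2,\ldots$ corresponding to the same $\lambda$ and to the eigenfunction $\overset{0}{\mathbf{y}}$ is any function $\overset{l}{\mathbf{y}}\in D(\mathbb{L})$ satisfying $\mathbb{L}\overset{l}{\mathbf{y}}=\lambda\overset{l}{\mathbf{y}}+\overset{l-1}{\mathbf{y}}$ almost everywhere on $(0,\pi)$, where $\overset{l-1}{\mathbf{y}}$ is an associated function of order $l-1$ (the eigenfunction itself if $l=1$). Eigenfunctions and associated functions of $\mathbb{L}^*$ are defined in the same way, with $\mathbb{L}^*$ in place of $\mathbb{L}$. A system is complete in $\mathbb{H}$ if its closed linear span is $\mathbb{H}$, and minimal if no element belongs to the closed linear span of the others. "Basis" means Schauder basis of $\mathbb{H}$. *)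

theory Defs
  imports "HOL-Analysis.Analysis"
begin

(* Elements of L_2 are represented by functions rather than by classes modulo null sets;
   values outside (0, pi) play no role for them, since only integrals and almost-everywhere
   statements over (0, pi) are used. *)

abbreviation leb_0_pi :: "real measure" where
  "leb_0_pi \<equiv> lebesgue_on {0<..<pi}"

definition H_space :: "(real \<Rightarrow> complex^2) set" where
  "H_space = {f. f \<in> borel_measurable leb_0_pi \<and> integrable leb_0_pi (\<lambda>x. (norm (f x))\<^sup>2)}"

definition H_inner :: "(real \<Rightarrow> complex^2) \<Rightarrow> (real \<Rightarrow> complex^2) \<Rightarrow> complex" where
  "H_inner f g = (LINT x|leb_0_pi. f x $ 1 * cnj (g x $ 1) + f x $ 2 * cnj (g x $ 2))"

definition H_norm :: "(real \<Rightarrow> complex^2) \<Rightarrow> real" where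
  "H_norm f = sqrt (Re (H_inner f f))"

definition lin_comb :: "(nat \<Rightarrow> complex) \<Rightarrow> (nat \<Rightarrow> real \<Rightarrow> complex^2) \<Rightarrow> nat set \<Rightarrow> real \<Rightarrow> complex^2"
  where "lin_comb c y A = (\<lambda>x. \<Sum>k\<in>A. c k *s y k x)"

definition closed_lin_span :: "(nat \<Rightarrow> real \<Rightarrow> complex^2) \<Rightarrow> nat set \<Rightarrow> (real \<Rightarrow> complex^2) set" where
  "closed_lin_span y I = {f \<in> H_space. \<forall>\<epsilon>>0. \<exists>A c. finite A \<and> A \<subseteq> I \<and>
      H_norm (\<lambda>x. f x - lin_comb c y A x) < \<epsilon>}"

definition complete_system :: "(nat \<Rightarrow> real \<Rightarrow> complex^2) \<Rightarrow> bool" where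
  "complete_system y \<longleftrightarrow> (\<forall>n. y n \<in> H_space) \<and> closed_lin_span y UNIV = H_space"

definition minimal_system :: "(nat \<Rightarrow> real \<Rightarrow> complex^2) \<Rightarrow> bool" where
  "minimal_system y \<longleftrightarrow> (\<forall>n. y n \<in> H_space) \<and> (\<forall>n. y n \<notin> closed_lin_span y (UNIV - {n}))"

definition schauder_basis :: "(nat \<Rightarrow> real \<Rightarrow> complex^2) \<Rightarrow> bool" where
  "schauder_basis y \<longleftrightarrow> (\<forall>n. y n \<in> H_space) \<and>
     (\<forall>f\<in>H_space. \<exists>!c :: nat \<Rightarrow> complex.
        (\<lambda>N. H_norm (\<lambda>x. f x - lin_comb c y {..<N} x)) \<longlonglongrightarrow> 0)"

(* The one-dimensional intervals of a division are of the form {a..b} with a <= b, so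
   Inf k and Sup k are the endpoints. *)
definition abs_continuous_on :: "real set \<Rightarrow> (real \<Rightarrow> complex) \<Rightarrow> bool" where
  "abs_continuous_on S f \<longleftrightarrow> (\<forall>\<epsilon>>0. \<exists>\<delta>>0. \<forall>D T. D division_of T \<and> T \<subseteq> S \<and>
      (\<Sum>k\<in>D. Sup k - Inf k) < \<delta> \<longrightarrow> (\<Sum>k\<in>D. norm (f (Sup k) - f (Inf k))) < \<epsilon>)"

(* By Lebesgue's theorem the last two conditions follow from absolute continuity. *)
definition W11 :: "(real \<Rightarrow> complex) set" where
  "W11 = {f. abs_continuous_on {0..pi} f \<and>
      (AE x in leb_0_pi. f differentiable at x) \<and>
      integrable leb_0_pi (\<lambda>x. vector_derivative f (at x))}"

definition B_matrix :: "complex^2^2" where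
  "B_matrix = vector [vector [- \<i>, 0], vector [0, \<i>]]"

definition potential :: "(real \<Rightarrow> complex) \<Rightarrow> (real \<Rightarrow> complex) \<Rightarrow> real \<Rightarrow> complex^2^2" where
  "potential P Q x = vector [vector [0, P x], vector [Q x, 0]]"

definition adj_potential :: "(real \<Rightarrow> complex) \<Rightarrow> (real \<Rightarrow> complex) \<Rightarrow> real \<Rightarrow> complex^2^2" where
  "adj_potential P Q x = vector [vector [0, cnj (Q x)], vector [cnj (P x), 0]]"

definition dirac :: "(real \<Rightarrow> complex^2^2) \<Rightarrow> (real \<Rightarrow> complex^2) \<Rightarrow> real \<Rightarrow> complex^2" where
  "dirac V y x = B_matrix *v vector_derivative y (at x) + V x *v y x"

definition dirac_domain :: "(real \<Rightarrow> complex^2^2) \<Rightarrow> (real \<Rightarrow> complex^2) set" where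
  "dirac_domain V = {y. (\<forall>i. (\<lambda>x. y x $ i) \<in> W11) \<and> dirac V y \<in> H_space}"

definition eigenfunction ::
    "(real \<Rightarrow> complex^2^2) \<Rightarrow> complex \<Rightarrow> (real \<Rightarrow> complex^2) \<Rightarrow> bool" where
  "eigenfunction V l y \<longleftrightarrow> y \<in> dirac_domain V \<and> (\<exists>x\<in>{0..pi}. y x \<noteq> 0) \<and>
     (AE x in leb_0_pi. dirac V y x = l *s y x)"

(* Order 0: eigenfunctions; order m > 0: associated functions of order m. *)
primrec root_function_of_order ::
    "(real \<Rightarrow> complex^2^2) \<Rightarrow> complex \<Rightarrow> nat \<Rightarrow> (real \<Rightarrow> complex^2) \<Rightarrow> bool" where
  "root_function_of_order V l 0 y \<longleftrightarrow> eigenfunction V l y"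
| "root_function_of_order V l (Suc m) y \<longleftrightarrow> y \<in> dirac_domain V \<and>
     (\<exists>u. root_function_of_order V l m u \<and> (AE x in leb_0_pi. dirac V y x = l *s y x + u x))"

definition root_function ::
    "(real \<Rightarrow> complex^2^2) \<Rightarrow> complex \<Rightarrow> (real \<Rightarrow> complex^2) \<Rightarrow> bool" where
  "root_function V l y \<longleftrightarrow> (\<exists>m. root_function_of_order V l m y)"

end

theory Submission
  imports Defs
begin

text \<open>
  If \<open>y\<close> were a basis, then the rank one terms \<open>\<langle>f, z n\<rangle> y n\<close> of the expansion of any \<open>f\<close>
  would tend to zero, and by uniform boundedness the products \<open>H_norm (y n) * H_norm (z n)\<close>
  would be bounded for large \<open>n\<close> (\<open>schauder_basis_biorthogonal_norms_bounded\<close>). The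
  contradiction comes from \<open>eigenfunction_norms_product_large\<close>: for eigenfunctions \<open>y\<close>, \<open>z\<close>
  with conjugate eigenvalues \<open>l\<close>, \<open>cnj l\<close> and \<open>\<langle>y, z\<rangle> = 1\<close>, the product of the norms exceeds
  any given constant once \<open>\<bar>Im l\<bar>\<close> is large. Associated functions occur for finitely many
  indices only, so they do not affect this argument.

  The mechanism is visible for \<open>P = Q = 0\<close>. The components of \<open>y\<close> are multiples of
  \<open>exp (\<i> l x)\<close> and \<open>exp (- \<i> l x)\<close>, those of \<open>z\<close> of \<open>exp (\<i> (cnj l) x)\<close> and
  \<open>exp (- \<i> (cnj l) x)\<close>. The exponentials cancel in \<open>y x $ i * cnj (z x $ i)\<close>, but not in the
  norms: on an interval with midpoint \<open>m\<close> and half-length \<open>r\<close>, each component of \<open>y\<close> or \<open>z\<close> is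
  larger than at \<open>m\<close> by a factor up to \<open>exp (\<bar>Im l\<bar> r)\<close> near one of the two ends. Hence the
  product of the local norms exceeds the local contribution to \<open>\<langle>y, z\<rangle>\<close> by a factor at least
  of the order of \<open>exp (\<bar>Im l\<bar> r)\<close>.

  With a potential the same comparison is made on intervals so short that \<open>\<bar>Im l\<bar> r\<close> stays
  between two fixed multiples of a large constant \<open>K\<close>. As \<open>\<bar>Im l\<bar>\<close> grows, the lengths shrink
  and the integral of \<open>\<bar>P\<bar> + \<bar>Q\<bar>\<close> over each interval becomes as small as desired, uniformly,
  so solutions stay close to free ones (\<open>dirac_solution_near_free\<close>) and the local gain
  survives (\<open>dirac_solutions_local_pairing\<close>). Summing over a partition of the interval by the
  Cauchy--Schwarz inequality preserves it (\<open>dirac_solutions_pairing_partition\<close>). Everything is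
  local, which is why integrability of \<open>P\<close> and \<open>Q\<close> suffices and no asymptotic formulas on the
  whole interval enter.
\<close>

section \<open>The fundamental theorem of calculus for absolutely continuous functions\<close>

lemma abs_continuous_on_subset:
  assumes "abs_continuous_on S f" "T \<subseteq> S"
  shows "abs_continuous_on T f"
  using assms unfolding abs_continuous_on_def by (meson subset_trans)

lemma abs_continuous_on_pair:
  assumes "abs_continuous_on {a..b} f" "e > 0"
  obtains d where "d > 0"
    "\<And>s t. \<lbrakk>a \<le> s; s \<le> t; t \<le> b; t - s < d\<rbrakk> \<Longrightarrow> norm (f t - f s) < e"
proof -
  obtain d where d: "d > 0" "\<And>D T. \<lbrakk>D division_of T; T \<subseteq> {a..b}; (\<Sum>k\<in>D. Sup k - Inf k) < d\<rbrakk>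
        \<Longrightarrow> (\<Sum>k\<in>D. norm (f (Sup k) - f (Inf k))) < e"
    using assms unfolding abs_continuous_on_def by metis
  show ?thesis
  proof (rule that[OF d(1)])
    fix s t :: real assume st: "a \<le> s" "s \<le> t" "t \<le> b" "t - s < d"
    have "{{s..t}} division_of {s..t}"
      using st division_of_self[of s t] by simp
    from d(2)[OF this] show "norm (f t - f s) < e"
      using st by simp
  qed
qed

lemma abs_continuous_on_imp_continuous_on:
  assumes "abs_continuous_on {a..b} f"
  shows "continuous_on {a..b} f"
proof (rule continuous_onI)
  fix x e :: real assume x: "x \<in> {a..b}" and e: "e > 0"
  obtain d where d: "d > 0"
    "\<And>s t. \<lbrakk>a \<le> s; s \<le> t; t \<le> b; t - s < d\<rbrakk> \<Longrightarrow> norm (f t - f s) < e"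
    using abs_continuous_on_pair[OF assms e] by blast
  show "\<exists>d>0. \<forall>x'\<in>{a..b}. dist x' x < d \<longrightarrow> dist (f x') (f x) \<le> e"
  proof (intro exI[of _ d] conjI ballI impI d(1))
    fix x' assume x': "x' \<in> {a..b}" "dist x' x < d"
    show "dist (f x') (f x) \<le> e"
    proof (cases "x \<le> x'")
      case True
      then show ?thesis using d(2)[of x x'] x x' by (auto simp: dist_norm)
    next
      case False
      then show ?thesis using d(2)[of x' x] x x' by (auto simp: dist_norm norm_minus_commute)
    qed
  qed
qed

lemma abs_continuous_on_mult_lipschitz:
  assumes f: "abs_continuous_on {a..b} f" and g: "L-lipschitz_on {a..b} g"
  shows "abs_continuous_on {a..b} (\<lambda>x. g x * f x)"
proof -
  have "bounded (f ` {a..b})" "bounded (g ` {a..b})"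
    using abs_continuous_on_imp_continuous_on[OF f] lipschitz_on_continuous_on[OF g]
    by (auto intro!: compact_imp_bounded compact_continuous_image)
  then obtain F G where F: "F > 0" "\<And>x. x \<in> {a..b} \<Longrightarrow> norm (f x) \<le> F"
    and G: "G > 0" "\<And>x. x \<in> {a..b} \<Longrightarrow> norm (g x) \<le> G"
    unfolding bounded_pos by auto
  have L: "L \<ge> 0" using g by (rule lipschitz_on_nonneg)
  show ?thesis
    unfolding abs_continuous_on_def
  proof (intro allI impI)
    fix e :: real assume e: "e > 0"
    have eG: "e / (2 * G) > 0" using e G(1) by simp
    obtain d where d: "d > 0" "\<And>D T. \<lbrakk>D division_of T; T \<subseteq> {a..b}; (\<Sum>k\<in>D. Sup k - Inf k) < d\<rbrakk>
        \<Longrightarrow> (\<Sum>k\<in>D. norm (f (Sup k) - f (Inf k))) < e / (2 * G)"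
      using f eG unfolding abs_continuous_on_def by metis
    define d' where "d' = min d (e / (2 * (F * (L + 1))))"
    have "(\<Sum>k\<in>D. norm (g (Sup k) * f (Sup k) - g (Inf k) * f (Inf k))) < e"
      if D: "D division_of T" "T \<subseteq> {a..b}" "(\<Sum>k\<in>D. Sup k - Inf k) < d'" for D T
    proof -
      have 1: "norm (g (Sup k) * f (Sup k) - g (Inf k) * f (Inf k))
               \<le> G * norm (f (Sup k) - f (Inf k)) + F * (L + 1) * (Sup k - Inf k)" if k: "k \<in> D" for k
      proof -
        obtain u v where uv: "k = {u..v}" "u \<le> v"
          using division_ofD(4,3)[OF D(1) k]
          by (metis atLeastatMost_empty_iff box_real(2))
        have "k \<subseteq> {a..b}" using division_ofD(2)[OF D(1) k] D(2) by blast
        then have uvab: "u \<in> {a..b}" "v \<in> {a..b}" using uv by auto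
        have "norm (g v - g u) \<le> L * (v - u)"
          using lipschitz_onD[OF g uvab(2) uvab(1)] uv(2) by (simp add: dist_norm)
        also have "\<dots> \<le> (L + 1) * (v - u)" using uv(2) by (simp add: mult_right_mono)
        finally have gl: "norm (g v - g u) \<le> (L + 1) * (v - u)" .
        have "g v * f v - g u * f u = g v * (f v - f u) + (g v - g u) * f u"
          by (simp add: algebra_simps)
        then have "norm (g v * f v - g u * f u) \<le> norm (g v) * norm (f v - f u) + norm (g v - g u) * norm (f u)"
          by (metis norm_mult norm_triangle_ineq)
        also have "\<dots> \<le> G * norm (f v - f u) + ((L + 1) * (v - u)) * F"
          using gl F uvab G L uv(2) by (intro add_mono mult_mono) auto
        finally show ?thesis using uv by (simp add: algebra_simps)
      qed
      have cancel: "c * (e / (2 * c)) = e / 2" if "c \<noteq> 0" for c :: real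
        using that by simp
      have "(\<Sum>k\<in>D. norm (g (Sup k) * f (Sup k) - g (Inf k) * f (Inf k)))
         \<le> (\<Sum>k\<in>D. G * norm (f (Sup k) - f (Inf k)) + F * (L + 1) * (Sup k - Inf k))"
        by (rule sum_mono) (rule 1)
      also have "\<dots> = G * (\<Sum>k\<in>D. norm (f (Sup k) - f (Inf k))) + F * (L + 1) * (\<Sum>k\<in>D. Sup k - Inf k)"
        by (simp add: sum.distrib sum_distrib_left)
      also have "\<dots> < G * (e / (2 * G)) + F * (L + 1) * (e / (2 * (F * (L + 1))))"
        using d(2)[OF D(1,2)] D(3) F G L
        by (intro add_strict_mono mult_strict_left_mono) (auto simp: d'_def)
      also have "G * (e / (2 * G)) = e / 2" using G by simp
      also have "F * (L + 1) * (e / (2 * (F * (L + 1)))) = e / 2"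
        by (rule cancel) (use F L in auto)
      finally show ?thesis by simp
    qed
    moreover have "d' > 0" using d(1) e F L by (auto simp: d'_def)
    ultimately show "\<exists>\<delta>>0. \<forall>D T. D division_of T \<and> T \<subseteq> {a..b} \<and> (\<Sum>k\<in>D. Sup k - Inf k) < \<delta> \<longrightarrow>
       (\<Sum>k\<in>D. norm (g (Sup k) * f (Sup k) - g (Inf k) * f (Inf k))) < e"
      by blast
  qed
qed

lemma negligible_open_cover:
  assumes "negligible N" "d > 0"
  obtains U where "open U" "N \<subseteq> U" "U \<in> lmeasurable" "measure lebesgue U < d"
proof -
  have N: "N \<in> null_sets lebesgue" using assms(1) by (simp add: negligible_iff_null_sets)
  obtain U where U: "open U" "N \<subseteq> U" "(U - N) \<in> lmeasurable" "emeasure lebesgue (U - N) < ennreal d"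
    using sets_lebesgue_outer_open[of N d] N assms(2) by blast
  have eq: "U = (U - N) \<union> N" using U(2) by blast
  have "emeasure lebesgue U < ennreal d"
    using U(3,4) N eq by (metis emeasure_Un_null_set fmeasurableD)
  moreover have "U \<in> lmeasurable"
    using U(3) eq N by (metis fmeasurable.Un negligible_iff_null_sets negligible_imp_measurable)
  ultimately show ?thesis
    using that U(1,2) assms(2)
    by (metis emeasure_eq_measure2 ennreal_less_iff measure_nonneg)
qed

text \<open>
  The standard gauge argument for everywhere differentiable functions works for tags outside
  \<open>N\<close>. Intervals tagged in \<open>N\<close> are forced into an open set of small measure around \<open>N\<close>, and
  there absolute continuity bounds the total increment of \<open>f\<close>.
\<close>

theorem fundamental_theorem_abs_continuous:
  fixes f :: "real \<Rightarrow> complex"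
  assumes "a \<le> b" and ac: "abs_continuous_on {a..b} f" and N: "negligible N"
    and deriv: "\<And>x. x \<in> {a..b} - N \<Longrightarrow> (f has_vector_derivative f' x) (at x)"
  shows "(f' has_integral (f b - f a)) {a..b}"
proof -
  \<comment> \<open>On \<open>N\<close> the integrand is set to zero, so that only increments of
    \<open>f\<close> remain for tags in \<open>N\<close>.\<close>
  define F where "F x = (if x \<in> N then 0 else f' x)" for x
  have "(F has_integral (f b - f a)) {a..b}"
    unfolding has_integral_real
  proof (intro allI impI)
    fix e :: real assume e: "e > 0"
    define e1 where "e1 = e / (4 * (b - a + 1))"
    have e1: "e1 > 0" using e \<open>a \<le> b\<close> by (simp add: e1_def)
    have "\<forall>x. \<exists>d>0. x \<in> {a..b} - N \<longrightarrow>
         (\<forall>y. norm (y-x) < d \<longrightarrow> norm (f y - f x - (y-x) *\<^sub>R f' x) \<le> e1 * norm (y-x))"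
      using deriv e1 unfolding has_vector_derivative_def has_derivative_at_alt
      by (metis zero_less_one)
    then obtain d where d: "\<And>x. 0 < d x"
                 "\<And>x y. \<lbrakk>x \<in> {a..b} - N; norm (y-x) < d x\<rbrakk>
                        \<Longrightarrow> norm (f y - f x - (y-x) *\<^sub>R f' x) \<le> e1 * norm (y-x)"
      by metis
    obtain \<delta> where \<delta>: "\<delta> > 0" "\<And>D T. \<lbrakk>D division_of T; T \<subseteq> {a..b}; (\<Sum>k\<in>D. Sup k - Inf k) < \<delta>\<rbrakk>
        \<Longrightarrow> (\<Sum>k\<in>D. norm (f (Sup k) - f (Inf k))) < e / 2"
      using ac e unfolding abs_continuous_on_def by (metis half_gt_zero)
    obtain U where U: "open U" "N \<subseteq> U" "U \<in> lmeasurable" "measure lebesgue U < \<delta>"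
      using negligible_open_cover[OF N \<delta>(1)] by blast
    define \<gamma> where "\<gamma> x = (if x \<in> N then U else ball x (d x))" for x
    have "gauge \<gamma>" using U d(1) by (auto simp: gauge_def \<gamma>_def)
    moreover have "norm ((\<Sum>(x,k)\<in>p. measure lborel k *\<^sub>R F x) - (f b - f a)) < e"
      if p: "p tagged_division_of {a..b}" and fine: "\<gamma> fine p" for p
    proof -
      have fin: "finite p" using p by blast
      define p1 where "p1 = {t \<in> p. fst t \<in> N}"
      have split: "p = p1 \<union> (p - p1)" "p1 \<inter> (p - p1) = {}" "finite p1" "finite (p - p1)"
        using fin by (auto simp: p1_def)
      have ab: "b - a = (\<Sum>(x,K)\<in>p. Sup K - Inf K)" "f b - f a = (\<Sum>(x,K)\<in>p. f (Sup K) - f (Inf K))"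
        using additive_tagged_division_1[OF \<open>a \<le> b\<close> p, of "\<lambda>x. x"]
              additive_tagged_division_1[OF \<open>a \<le> b\<close> p, of f] by auto
      have K: "\<exists>u v. k = {u..v} \<and> u \<le> x \<and> x \<le> v \<and> a \<le> u \<and> v \<le> b" if xk: "(x,k) \<in> p" for x k
      proof -
        obtain u v where uv: "k = cbox u v" using tagged_division_ofD(4)[OF p xk] by blast
        have "x \<in> k" "k \<subseteq> {a..b}" using tagged_division_ofD(2,3)[OF p xk] by auto
        then show ?thesis using uv by auto
      qed
      have off: "norm (\<Sum>(x,K)\<in>p - p1. measure lborel K *\<^sub>R F x - (f (Sup K) - f (Inf K)))
                  \<le> e1 * (b - a)"
      proof -
        have "norm (\<Sum>(x,K)\<in>p - p1. measure lborel K *\<^sub>R F x - (f (Sup K) - f (Inf K)))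
              \<le> (\<Sum>(x,K)\<in>p - p1. e1 * (Sup K - Inf K))"
        proof (rule sum_norm_le, safe)
          fix x k assume xk: "(x,k) \<in> p" "(x,k) \<notin> p1"
          obtain u v where uv: "k = {u..v}" "u \<le> x" "x \<le> v" "a \<le> u" "v \<le> b" using K[OF xk(1)] by blast
          have xN: "x \<in> {a..b} - N" using xk uv by (auto simp: p1_def)
          have "k \<subseteq> ball x (d x)" using fineD[OF fine xk(1)] xN by (simp add: \<gamma>_def)
          then have "u \<in> ball x (d x)" "v \<in> ball x (d x)" using uv by (auto simp del: mem_ball)
          then have du: "norm (f u - f x - (u-x) *\<^sub>R f' x) \<le> e1 * norm (u-x)"
            and dv: "norm (f v - f x - (v-x) *\<^sub>R f' x) \<le> e1 * norm (v-x)"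
            using d(2)[OF xN] by (auto simp: dist_norm norm_minus_commute)
          have "measure lborel k *\<^sub>R F x - (f (Sup k) - f (Inf k))
                = (f u - f x - (u-x) *\<^sub>R f' x) - (f v - f x - (v-x) *\<^sub>R f' x)"
            using uv xN by (simp add: F_def algebra_simps)
          also have "norm \<dots> \<le> e1 * norm (u-x) + e1 * norm (v-x)"
            using du dv norm_triangle_ineq4 by (smt (verit))
          also have "\<dots> = e1 * (Sup k - Inf k)" using uv by (simp add: algebra_simps)
          finally show "norm (measure lborel k *\<^sub>R F x - (f (Sup k) - f (Inf k))) \<le> e1 * (Sup k - Inf k)" .
        qed
        also have "\<dots> \<le> (\<Sum>(x,K)\<in>p. e1 * (Sup K - Inf K))"
        proof (rule sum_mono2[OF fin])
          fix t assume "t \<in> p - (p - p1)"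
          then obtain x k where t: "t = (x,k)" "(x,k) \<in> p" by (cases t) auto
          then obtain u v where uv: "k = {u..v}" "u \<le> x" "x \<le> v" using K by blast
          then show "0 \<le> (case t of (x,K) \<Rightarrow> e1 * (Sup K - Inf K))" using e1 t by simp
        qed blast
        also have "\<dots> = e1 * (b - a)" unfolding ab(1) by (simp add: sum_distrib_left case_prod_unfold)
        finally show ?thesis .
      qed
      have on: "norm (\<Sum>(x,K)\<in>p1. measure lborel K *\<^sub>R F x - (f (Sup K) - f (Inf K))) < e / 2"
      proof -
        have p1p: "p1 tagged_partial_division_of {a..b}"
          using p tagged_partial_division_subset[of p "{a..b}" p1]
          by (auto simp: tagged_division_of_def p1_def)
        then have p1: "p1 tagged_division_of \<Union>(snd ` p1)"
          by (rule tagged_partial_division_of_Union_self)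
        then have div: "snd ` p1 division_of \<Union>(snd ` p1)" by (rule division_of_tagged_division)
        have sub: "\<Union>(snd ` p1) \<subseteq> {a..b}" using K by (fastforce simp: p1_def)
        have subU: "\<Union>(snd ` p1) \<subseteq> U" using fine by (force simp: p1_def fine_def \<gamma>_def)
        have "(\<Sum>k\<in>snd ` p1. Sup k - Inf k) = (\<Sum>k\<in>snd ` p1. measure lebesgue k)"
        proof (rule sum.cong[OF refl])
          fix k assume "k \<in> snd ` p1"
          then obtain u v where "k = {u..v}" "u \<le> v" using K by (force simp: p1_def)
          then show "Sup k - Inf k = measure lebesgue k" by simp
        qed
        also have "\<dots> = measure lebesgue (\<Union>(snd ` p1))" using content_division[OF div] by simp
        also have "\<dots> \<le> measure lebesgue U"
          using subU U(3) lmeasurable_division[OF div] by (intro measure_mono_fmeasurable) auto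
        finally have "(\<Sum>k\<in>snd ` p1. Sup k - Inf k) < \<delta>" using U(4) by simp
        \<comment> \<open>The summand is made zero on the empty set because the passage from tagged pairs to
          intervals requires it to vanish on all degenerate intervals, and \<open>Sup\<close> and
          \<open>Inf\<close> of the empty set are arbitrary.\<close>
        define d0 where "d0 K = (if K = {} then 0 else norm (f (Sup K) - f (Inf K)))" for K
        from \<delta>(2)[OF div sub \<open>(\<Sum>k\<in>snd ` p1. Sup k - Inf k) < \<delta>\<close>]
        have small: "(\<Sum>k\<in>snd ` p1. norm (f (Sup k) - f (Inf k))) < e / 2" .
        have "norm (\<Sum>(x,K)\<in>p1. measure lborel K *\<^sub>R F x - (f (Sup K) - f (Inf K)))
              \<le> (\<Sum>(x,K)\<in>p1. norm (f (Sup K) - f (Inf K)))"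
          by (rule sum_norm_le) (auto simp: p1_def F_def norm_minus_commute)
        also have "\<dots> = (\<Sum>(x,K)\<in>p1. d0 K)"
          using K by (intro sum.cong) (force simp: p1_def d0_def)+
        also have "\<dots> = (\<Sum>k\<in>snd ` p1. d0 k)"
        proof (rule sum.over_tagged_division_lemma[OF p1])
          fix u v :: real assume "box u v = {}"
          then have "cbox u v = {} \<or> u = v" by (auto simp: box_eq_empty)
          then show "d0 (cbox u v) = 0" by (auto simp: d0_def)
        qed
        also have "\<dots> \<le> (\<Sum>k\<in>snd ` p1. norm (f (Sup k) - f (Inf k)))"
          by (rule sum_mono) (simp add: d0_def)
        finally show ?thesis using small by simp
      qed
      have "(\<Sum>(x,k)\<in>p. measure lborel k *\<^sub>R F x) - (f b - f a)
            = (\<Sum>(x,K)\<in>p. measure lborel K *\<^sub>R F x - (f (Sup K) - f (Inf K)))"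
        unfolding ab(2) by (simp add: sum_subtractf case_prod_unfold)
      also have "\<dots> = (\<Sum>(x,K)\<in>p1. measure lborel K *\<^sub>R F x - (f (Sup K) - f (Inf K)))
                   + (\<Sum>(x,K)\<in>p - p1. measure lborel K *\<^sub>R F x - (f (Sup K) - f (Inf K)))"
        by (subst split(1)) (rule sum.union_disjoint[OF split(3,4,2)])
      finally have "norm ((\<Sum>(x,k)\<in>p. measure lborel k *\<^sub>R F x) - (f b - f a)) < e / 2 + e1 * (b - a)"
        using on off by (smt (verit) norm_triangle_ineq)
      also have "e1 * (b - a) \<le> e1 * (b - a + 1)" using e1 by (intro mult_left_mono) auto
      also have "\<dots> = e / 4"
      proof -
        have "b - a + 1 \<noteq> 0" using \<open>a \<le> b\<close> by simp
        then show ?thesis unfolding e1_def times_divide_eq_left by (rule mult_divide_mult_cancel_right)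
      qed
      finally show ?thesis using e by simp
    qed
    ultimately show "\<exists>\<gamma>. gauge \<gamma> \<and> (\<forall>\<D>. \<D> tagged_division_of {a..b} \<and> \<gamma> fine \<D> \<longrightarrow>
        norm ((\<Sum>(x,k)\<in>\<D>. measure lborel k *\<^sub>R F x) - (f b - f a)) < e)"
      by (intro exI[of _ \<gamma>]) simp
  qed
  then show ?thesis
    by (rule has_integral_spike[OF N, rotated]) (simp add: F_def)
qed

text \<open>
  This is how absolute continuity is used below: an almost everywhere bound on the derivative,
  as provided by the differential equation, becomes a bound on increments.
\<close>

lemma abs_continuous_increment_bound:
  fixes f :: "real \<Rightarrow> complex"
  assumes "a \<le> b" and ac: "abs_continuous_on {a..b} f" and N: "negligible N"
    and deriv: "\<And>x. x \<in> {a..b} - N \<Longrightarrow> (f has_vector_derivative f' x) (at x)"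
    and bd: "\<And>x. x \<in> {a..b} - N \<Longrightarrow> norm (f' x) \<le> g x"
    and g: "g integrable_on {a..b}"
  shows "norm (f b - f a) \<le> integral {a..b} g"
proof -
  define F where "F x = (if x \<in> N then 0 else f' x)" for x
  define G where "G x = (if x \<in> N then 0 else g x)" for x
  have "(F has_integral (f b - f a)) {a..b}"
    by (rule fundamental_theorem_abs_continuous[OF \<open>a \<le> b\<close> ac N]) (use deriv in \<open>auto simp: F_def\<close>)
  moreover have "(G has_integral integral {a..b} g) {a..b}"
    by (rule has_integral_spike[OF N _ integrable_integral[OF g]]) (simp add: G_def)
  ultimately show ?thesis
    using integral_norm_bound_integral[of F "{a..b}" G] bd
    by (auto simp: has_integral_iff F_def G_def)
qed

section \<open>First-order systems on a short interval\<close>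

text \<open>
  Both operators lead to this form, with \<open>\<mu> = \<i> * l\<close> for the operator itself and
  \<open>\<mu> = \<i> * cnj l\<close> for its adjoint; the free parts \<open>\<mu>\<close> and \<open>- \<mu>\<close> are separated from the
  coupling \<open>\<alpha>\<close>, \<open>\<beta>\<close> through the potential. The equations are required off a null set.
\<close>

definition dirac_solution ::
    "real \<Rightarrow> real \<Rightarrow> complex \<Rightarrow> (real \<Rightarrow> complex) \<Rightarrow> (real \<Rightarrow> complex) \<Rightarrow> (real \<Rightarrow> complex) \<Rightarrow> (real \<Rightarrow> complex) \<Rightarrow> bool"
  where "dirac_solution a b \<mu> \<alpha> \<beta> f g \<longleftrightarrow>
    abs_continuous_on {a..b} f \<and> abs_continuous_on {a..b} g \<and>
    (\<exists>N. negligible N \<and> (\<forall>x\<in>{a..b} - N.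
       (f has_vector_derivative (\<mu> * f x + \<alpha> x * g x)) (at x) \<and>
       (g has_vector_derivative (- \<mu> * g x + \<beta> x * f x)) (at x)))"

lemma dirac_solution_swap:
  "dirac_solution a b \<mu> \<alpha> \<beta> f g \<Longrightarrow> dirac_solution a b (- \<mu>) \<beta> \<alpha> g f"
  unfolding dirac_solution_def by (simp add: conj_commute)

lemma dirac_solution_subinterval:
  assumes "dirac_solution a b \<mu> \<alpha> \<beta> f g" "a \<le> c" "d \<le> b"
  shows "dirac_solution c d \<mu> \<alpha> \<beta> f g"
proof -
  have sub: "{c..d} \<subseteq> {a..b}" using assms by auto
  obtain N where N: "negligible N" "\<And>x. x \<in> {a..b} - N \<Longrightarrow>
       (f has_vector_derivative (\<mu> * f x + \<alpha> x * g x)) (at x) \<and>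
       (g has_vector_derivative (- \<mu> * g x + \<beta> x * f x)) (at x)"
    using assms(1) unfolding dirac_solution_def by blast
  show ?thesis
    unfolding dirac_solution_def
  proof (intro conjI exI[of _ N])
    show "abs_continuous_on {c..d} f" "abs_continuous_on {c..d} g"
      using assms(1) sub abs_continuous_on_subset unfolding dirac_solution_def by blast+
    show "\<forall>x\<in>{c..d} - N. (f has_vector_derivative (\<mu> * f x + \<alpha> x * g x)) (at x) \<and>
       (g has_vector_derivative (- \<mu> * g x + \<beta> x * f x)) (at x)"
      using N(2) sub by blast
  qed (rule N(1))
qed

lemma dirac_solution_continuous:
  assumes "dirac_solution a b \<mu> \<alpha> \<beta> f g"
  shows "continuous_on {a..b} f" "continuous_on {a..b} g"
  using assms abs_continuous_on_imp_continuous_on unfolding dirac_solution_def by blast+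

text \<open>
  Variation of constants: after the free exponential is divided out of \<open>f\<close>, only the coupling
  term contributes to the derivative. Expressed through the other component, also freed of its
  exponential, that term carries the factor \<open>exp (- 2 * \<mu> * (x - m))\<close>, whose modulus
  on the interval is at most \<open>exp (2 * (\<bar>Re \<mu>\<bar> * r))\<close>. This is the factor in the smallness condition.
\<close>

lemma rotated_component_variation:
  fixes \<mu> :: complex and m r :: real
  assumes sol: "dirac_solution (m - r) (m + r) \<mu> \<alpha> \<beta> f g"
    and q: "q integrable_on {m - r..m + r}" "\<And>x. norm (\<alpha> x) \<le> q x"
    and M: "\<And>x. x \<in> {m - r..m + r} \<Longrightarrow> norm (exp (\<mu> * (x - m)) * g x) \<le> M"
    and small: "exp (2 * (\<bar>Re \<mu>\<bar> * r)) * integral {m - r..m + r} q \<le> 1 / 3"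
    and x: "x \<in> {m - r..m + r}"
  shows "norm (exp (- \<mu> * (x - m)) * f x - f m) \<le> M / 3"
proof -
  define J where "J = {m - r..m + r}"
  have m: "m \<in> J" and r: "0 \<le> r" using x by (auto simp: J_def)
  have M0: "0 \<le> M" using M[of m] m norm_ge_zero order_trans unfolding J_def by blast
  have q0: "0 \<le> q t" for t using q(2)[of t] norm_ge_zero order_trans by blast
  define E where "E = exp (2 * (\<bar>Re \<mu>\<bar> * r))"
  define e where "e t = exp (- \<mu> * (of_real t - of_real m))" for t :: real
  define u where "u t = e t * f t" for t
  obtain N where N: "negligible N" "\<And>t. t \<in> J - N \<Longrightarrow>
       (f has_vector_derivative (\<mu> * f t + \<alpha> t * g t)) (at t)"
    using sol unfolding dirac_solution_def J_def by blast
  have de: "(e has_vector_derivative (- \<mu> * e t)) (at t)" for t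
  proof -
    have "((\<lambda>z. exp (- \<mu> * (z - of_real m))) has_field_derivative (- \<mu> * e t)) (at (of_real t))"
      unfolding e_def by (auto intro!: derivative_eq_intros)
    from has_vector_derivative_real_field[OF this]
    show ?thesis by (simp add: e_def[abs_def])
  qed
  obtain L where L: "L-lipschitz_on J e"
  proof -
    have "continuous_on J (\<lambda>t. - \<mu> * e t)" unfolding e_def by (intro continuous_intros)
    then have "bounded ((\<lambda>t. - \<mu> * e t) ` J)"
      by (intro compact_imp_bounded compact_continuous_image) (auto simp: J_def)
    then obtain L where L: "L > 0" "\<forall>t\<in>J. norm (- \<mu> * e t) \<le> L"
      unfolding bounded_pos by auto
    have "L-lipschitz_on J e"
    proof (rule bounded_derivative_imp_lipschitz)
      show "(e has_derivative (\<lambda>h. h *\<^sub>R (- \<mu> * e t))) (at t within J)" for t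
        using de[of t] unfolding has_vector_derivative_def by (rule has_derivative_at_withinI)
      show "convex J" by (simp add: J_def)
      show "0 \<le> L" using L by simp
      show "onorm (\<lambda>h. h *\<^sub>R (- \<mu> * e t)) \<le> L" if "t \<in> J" for t
      proof (rule onorm_le)
        fix h :: real
        show "norm (h *\<^sub>R (- \<mu> * e t)) \<le> L * norm h"
          using L(2) that mult_right_mono[of "norm (- \<mu> * e t)" L "\<bar>h\<bar>"] by (simp add: mult.commute)
      qed
    qed
    then show ?thesis using that by blast
  qed
  have acu: "abs_continuous_on J u"
    unfolding u_def J_def
    using abs_continuous_on_mult_lipschitz[OF _ L[unfolded J_def]] sol
    unfolding dirac_solution_def by blast
  have du: "(u has_vector_derivative (exp (-2 * \<mu> * (t - m)) * \<alpha> t * (exp (\<mu> * (t - m)) * g t))) (at t)"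
    if t: "t \<in> J - N" for t
  proof -
    have "(u has_vector_derivative (e t * (\<mu> * f t + \<alpha> t * g t) + (- \<mu> * e t) * f t)) (at t)"
      unfolding u_def using has_vector_derivative_mult[OF de N(2)[OF t]] by simp
    also have "e t * (\<mu> * f t + \<alpha> t * g t) + (- \<mu> * e t) * f t = e t * \<alpha> t * g t"
      by (simp add: algebra_simps)
    also have "e t = exp (-2 * \<mu> * (t - m)) * exp (\<mu> * (t - m))"
      unfolding e_def mult_exp_exp by (simp add: algebra_simps)
    finally show ?thesis by (simp add: mult_ac)
  qed
  have bd: "norm (exp (-2 * \<mu> * (t - m)) * \<alpha> t * (exp (\<mu> * (t - m)) * g t)) \<le> E * M * q t"
    if t: "t \<in> J" for t
  proof -
    have "\<bar>t - m\<bar> \<le> r" using t by (auto simp: J_def)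
    then have "\<bar>Re \<mu> * (t - m)\<bar> \<le> \<bar>Re \<mu>\<bar> * r" by (simp add: abs_mult mult_left_mono)
    then have "- 2 * (Re \<mu> * (t - m)) \<le> 2 * (\<bar>Re \<mu>\<bar> * r)" by linarith
    moreover have "Re (-2 * \<mu> * (t - m)) = - 2 * (Re \<mu> * (t - m))" by simp
    ultimately have "norm (exp (-2 * \<mu> * (t - m))) \<le> E"
      unfolding E_def norm_exp_eq_Re by (metis exp_le_cancel_iff)
    then have "norm (exp (-2 * \<mu> * (t - m))) * norm (\<alpha> t) * norm (exp (\<mu> * (t - m)) * g t) \<le> E * q t * M"
      using q(2) M t q0 by (intro mult_mono) (auto simp: J_def E_def)
    then show ?thesis by (simp add: norm_mult mult_ac)
  qed
  have inc: "norm (u d - u c) \<le> M / 3" if cd: "c \<le> d" "{c..d} \<subseteq> J" for c d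
  proof -
    have qcd: "(\<lambda>t. E * M * q t) integrable_on {c..d}"
      using integrable_on_subinterval[OF q(1)] cd(2) by (auto simp: J_def intro!: integrable_on_mult_right)
    have qJ: "(\<lambda>t. E * M * q t) integrable_on J"
      using q(1) by (auto simp: J_def intro!: integrable_on_mult_right)
    have "norm (u d - u c) \<le> integral {c..d} (\<lambda>t. E * M * q t)"
      using cd(2)
      by (intro abs_continuous_increment_bound[OF cd(1) abs_continuous_on_subset[OF acu cd(2)] N(1) du bd qcd]) auto
    also have "\<dots> \<le> integral J (\<lambda>t. E * M * q t)"
      using M0 q0 by (intro integral_subset_le cd(2) qcd qJ) (simp add: E_def)
    also have "\<dots> = M * (E * integral J q)" by simp
    also have "\<dots> \<le> M * (1 / 3)"
      using small M0 unfolding E_def J_def by (rule mult_left_mono)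
    finally show ?thesis by simp
  qed
  have um: "u m = f m" by (simp add: u_def e_def)
  have "norm (u x - u m) \<le> M / 3"
  proof (cases "m \<le> x")
    case True
    then show ?thesis using inc[of m x] x m by (auto simp: J_def)
  next
    case False
    then show ?thesis using inc[of x m] x m by (auto simp: J_def norm_minus_commute)
  qed
  then show ?thesis unfolding um by (simp add: u_def e_def)
qed

text \<open>
  Let \<open>M\<close> be the maximum over the interval of the moduli of both components freed of their
  exponentials. By the previous lemma these components vary by at most \<open>M / 3\<close>, hence
  \<open>M \<le> W + M / 3\<close> and \<open>M / 3 \<le> W / 2\<close>. Taking the maximum directly replaces a Gronwall
  estimate.
\<close>

lemma dirac_solution_near_free:
  fixes \<mu> :: complex and m r :: real
  assumes sol: "dirac_solution (m - r) (m + r) \<mu> \<alpha> \<beta> f g"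
    and q: "q integrable_on {m - r..m + r}" "\<And>x. norm (\<alpha> x) \<le> q x" "\<And>x. norm (\<beta> x) \<le> q x"
    and small: "exp (2 * (\<bar>Re \<mu>\<bar> * r)) * integral {m - r..m + r} q \<le> 1 / 3"
    and W: "norm (f m) \<le> W" "norm (g m) \<le> W"
    and x: "x \<in> {m - r..m + r}"
  shows "norm (exp (- \<mu> * (x - m)) * f x - f m) \<le> W / 2"
    and "norm (exp (\<mu> * (x - m)) * g x - g m) \<le> W / 2"
proof -
  define J where "J = {m - r..m + r}"
  define u where "u t = exp (- \<mu> * (of_real t - of_real m)) * f t" for t :: real
  define v where "v t = exp (\<mu> * (of_real t - of_real m)) * g t" for t :: real
  have "continuous_on J (\<lambda>t. max (norm (u t)) (norm (v t)))"
    using dirac_solution_continuous[OF sol] unfolding u_def v_def J_def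
    by (intro continuous_intros)
  then obtain x0 where x0: "x0 \<in> J" "\<And>t. t \<in> J \<Longrightarrow> max (norm (u t)) (norm (v t)) \<le> max (norm (u x0)) (norm (v x0))"
    using continuous_attains_sup[of J "\<lambda>t. max (norm (u t)) (norm (v t))"] x
    by (auto simp: J_def)
  define M where "M = max (norm (u x0)) (norm (v x0))"
  have Mu: "norm (u t) \<le> M" and Mv: "norm (v t) \<le> M" if "t \<in> J" for t
    using x0(2)[OF that] by (auto simp: M_def)
  have u: "norm (u t - f m) \<le> M / 3" if "t \<in> J" for t
    using rotated_component_variation[OF sol q(1,2) _ small, of M t] Mv that
    by (simp add: u_def v_def J_def)
  have v: "norm (v t - g m) \<le> M / 3" if "t \<in> J" for t
    using rotated_component_variation[OF dirac_solution_swap[OF sol] q(1,3), of M t] Mu that small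
    by (simp add: u_def v_def J_def)
  have "M \<le> W + M / 3"
  proof (cases "norm (u x0) \<ge> norm (v x0)")
    case True
    then have "M = norm (f m + (u x0 - f m))" by (simp add: M_def)
    also have "\<dots> \<le> W + M / 3" using u[OF x0(1)] W(1) norm_triangle_ineq by (smt (verit))
    finally show ?thesis .
  next
    case False
    then have "M = norm (g m + (v x0 - g m))" by (simp add: M_def)
    also have "\<dots> \<le> W + M / 3" using v[OF x0(1)] W(2) norm_triangle_ineq by (smt (verit))
    finally show ?thesis .
  qed
  then have "M / 3 \<le> W / 2" by simp
  then show "norm (exp (- \<mu> * (x - m)) * f x - f m) \<le> W / 2"
    and "norm (exp (\<mu> * (x - m)) * g x - g m) \<le> W / 2"
    using u[of x] v[of x] x by (simp_all add: J_def u_def v_def)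
qed

text \<open>
  On the outer quarter of the interval on the side where \<open>exp (2 * \<rho> * (x - m))\<close> grows, the
  exponential is at least \<open>exp (\<bar>\<rho>\<bar> * r)\<close>.
\<close>

lemma integral_exp_lower_bound:
  fixes h :: "real \<Rightarrow> real"
  assumes "0 \<le> r" "0 \<le> c" and h: "continuous_on {m - r..m + r} h"
    and lb: "\<And>x. x \<in> {m - r..m + r} \<Longrightarrow> c * exp (2 * \<rho> * (x - m)) \<le> h x"
  shows "c * (r / 2) * exp (\<bar>\<rho>\<bar> * r) \<le> integral {m - r..m + r} h"
proof -
  define a where "a = (if \<rho> \<ge> 0 then m + r / 2 else m - r)"
  define b where "b = (if \<rho> \<ge> 0 then m + r else m - r / 2)"
  have sub: "{a..b} \<subseteq> {m - r..m + r}" and ab: "b - a = r / 2" "a \<le> b"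
    using assms(1) by (auto simp: a_def b_def)
  have big: "c * exp (\<bar>\<rho>\<bar> * r) \<le> h x" if x: "x \<in> {a..b}" for x
  proof -
    have "\<bar>\<rho>\<bar> * r \<le> 2 * \<rho> * (x - m)"
    proof (cases "\<rho> \<ge> 0")
      case True
      then have "r \<le> 2 * (x - m)" using x by (auto simp: a_def)
      then have "\<rho> * r \<le> \<rho> * (2 * (x - m))" using True by (rule mult_left_mono)
      then show ?thesis using True by (simp add: mult_ac)
    next
      case False
      then have "r \<le> 2 * (m - x)" using x by (auto simp: b_def)
      then have "(- \<rho>) * r \<le> (- \<rho>) * (2 * (m - x))" using False by (intro mult_left_mono) auto
      then show ?thesis using False by (simp add: algebra_simps)
    qed
    then have "c * exp (\<bar>\<rho>\<bar> * r) \<le> c * exp (2 * \<rho> * (x - m))"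
      using assms(2) by (intro mult_left_mono) auto
    also have "\<dots> \<le> h x" using lb x sub by blast
    finally show ?thesis .
  qed
  have hJ: "h integrable_on {m - r..m + r}" using h by (rule integrable_continuous_interval)
  have hI: "h integrable_on {a..b}" by (rule integrable_on_subinterval[OF hJ sub])
  have "c * (r / 2) * exp (\<bar>\<rho>\<bar> * r) = integral {a..b} (\<lambda>x. c * exp (\<bar>\<rho>\<bar> * r))"
    using ab by simp
  also have "\<dots> \<le> integral {a..b} h"
    using hI big by (intro integral_le) (auto intro: integrable_const_ivl)
  also have "\<dots> \<le> integral {m - r..m + r} h"
  proof (rule integral_subset_le[OF sub hI hJ], rule ballI)
    fix x assume "x \<in> {m - r..m + r}"
    then show "0 \<le> h x" using lb[of x] assms(2) by (meson exp_ge_zero mult_nonneg_nonneg order_trans)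
  qed
  finally show ?thesis .
qed

text \<open>
  The component that is larger at the midpoint keeps at least half of its free size
  throughout, and its free modulus grows exponentially towards one end of the interval.
\<close>

lemma dirac_solution_energy_bound:
  fixes \<mu> :: complex and m r :: real
  assumes sol: "dirac_solution (m - r) (m + r) \<mu> \<alpha> \<beta> f g"
    and q: "q integrable_on {m - r..m + r}" "\<And>x. norm (\<alpha> x) \<le> q x" "\<And>x. norm (\<beta> x) \<le> q x"
    and small: "exp (2 * (\<bar>Re \<mu>\<bar> * r)) * integral {m - r..m + r} q \<le> 1 / 3"
    and r: "0 \<le> r"
  defines "W \<equiv> max (norm (f m)) (norm (g m))"
  shows "W\<^sup>2 * r * exp (\<bar>Re \<mu>\<bar> * r) / 8
    \<le> integral {m - r..m + r} (\<lambda>x. (norm (f x))\<^sup>2 + (norm (g x))\<^sup>2)"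
proof -
  have W: "norm (f m) \<le> W" "norm (g m) \<le> W" "0 \<le> W" by (auto simp: W_def le_max_iff_disj)
  note near = dirac_solution_near_free[OF sol q small W(1,2)]
  have cont: "continuous_on {m - r..m + r} (\<lambda>x. (norm (f x))\<^sup>2 + (norm (g x))\<^sup>2)"
    using dirac_solution_continuous[OF sol] by (intro continuous_intros)
  have key: "W\<^sup>2 / 4 * exp (2 * Re \<nu> * s) \<le> (norm w)\<^sup>2"
    if "norm (exp (- \<nu> * of_real s) * w - w0) \<le> W / 2" "norm w0 = W" for \<nu> w w0 :: complex and s :: real
  proof -
    have "W / 2 \<le> norm (exp (- \<nu> * of_real s) * w)"
      using that norm_triangle_ineq2[of w0 "exp (- \<nu> * of_real s) * w"] by (simp add: norm_minus_commute)
    also have "\<dots> = exp (- Re \<nu> * s) * norm w" by (simp add: norm_mult norm_exp_eq_Re)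
    finally have "exp (Re \<nu> * s) * (W / 2) \<le> exp (Re \<nu> * s) * (exp (- Re \<nu> * s) * norm w)"
      by (intro mult_left_mono) auto
    also have "\<dots> = norm w" by (simp add: mult_exp_exp flip: mult.assoc)
    finally have "(exp (Re \<nu> * s) * (W / 2))\<^sup>2 \<le> (norm w)\<^sup>2" using W(3) by (intro power_mono) auto
    then show ?thesis by (simp add: power_mult_distrib power_divide mult_ac flip: exp_double)
  qed
  have "W\<^sup>2 / 4 * (r / 2) * exp (\<bar>Re \<mu>\<bar> * r)
    \<le> integral {m - r..m + r} (\<lambda>x. (norm (f x))\<^sup>2 + (norm (g x))\<^sup>2)"
  proof (cases "norm (f m) = W")
    case True
    show ?thesis
    proof (rule integral_exp_lower_bound[OF r _ cont])
      fix x assume x: "x \<in> {m - r..m + r}"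
      have "W\<^sup>2 / 4 * exp (2 * Re \<mu> * (x - m)) \<le> (norm (f x))\<^sup>2"
        using key[of \<mu> "x - m" "f x", OF _ True] near(1)[OF x] by simp
      then show "W\<^sup>2 / 4 * exp (2 * Re \<mu> * (x - m)) \<le> (norm (f x))\<^sup>2 + (norm (g x))\<^sup>2"
        by (smt (verit) zero_le_power2)
    qed simp
  next
    case False
    then have gW: "norm (g m) = W" by (auto simp: W_def max_def split: if_splits)
    have "W\<^sup>2 / 4 * (r / 2) * exp (\<bar>- Re \<mu>\<bar> * r)
      \<le> integral {m - r..m + r} (\<lambda>x. (norm (f x))\<^sup>2 + (norm (g x))\<^sup>2)"
    proof (rule integral_exp_lower_bound[OF r _ cont])
      fix x assume x: "x \<in> {m - r..m + r}"
      have "W\<^sup>2 / 4 * exp (2 * (- Re \<mu>) * (x - m)) \<le> (norm (g x))\<^sup>2"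
        using key[of "- \<mu>" "x - m" "g x", OF _ gW] near(2)[OF x] by simp
      then show "W\<^sup>2 / 4 * exp (2 * (- Re \<mu>) * (x - m)) \<le> (norm (f x))\<^sup>2 + (norm (g x))\<^sup>2"
        by (smt (verit) zero_le_power2)
    qed simp
    then show ?thesis by simp
  qed
  then show ?thesis by simp
qed

section \<open>Pairing two solutions with opposite growth\<close>

text \<open>
  By convention the integral of a function that is not integrable is zero.
\<close>

lemma integral_nonneg_total:
  fixes f :: "real \<Rightarrow> real"
  assumes "\<And>x. 0 \<le> f x"
  shows "0 \<le> integral S f"
  using assms by (cases "f integrable_on S")
    (auto simp: not_integrable_integral intro: Henstock_Kurzweil_Integration.integral_nonneg)

text \<open>
  Let \<open>W\<close> and \<open>W'\<close> be the larger moduli of the components of the two solutions at the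
  midpoint. The growth rates \<open>Re \<mu>\<close> and \<open>Re \<mu>'\<close> are opposite, so the exponentials cancel in
  the integrand on the left, whose modulus is at most \<open>9 / 2 * (W * W')\<close>; its integral is at
  most \<open>9 * (W * W') * r\<close>. By the energy bound each factor on the right contains
  \<open>exp (\<bar>Re \<mu>\<bar> * r)\<close> under the root, so the two together are at least
  \<open>W * W' * r * exp (\<bar>Re \<mu>\<bar> * r) / 8\<close>. The quotient of these bounds gives the constant
  \<open>72 = 9 * 8\<close>.
\<close>

lemma dirac_solutions_local_pairing:
  fixes \<mu> \<mu>' :: complex and m r :: real
  assumes sol: "dirac_solution (m - r) (m + r) \<mu> \<alpha> \<beta> f g"
    and sol': "dirac_solution (m - r) (m + r) \<mu>' \<alpha>' \<beta>' f' g'"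
    and opp: "Re \<mu>' = - Re \<mu>"
    and q: "q integrable_on {m - r..m + r}"
      "\<And>x. norm (\<alpha> x) \<le> q x" "\<And>x. norm (\<beta> x) \<le> q x"
      "\<And>x. norm (\<alpha>' x) \<le> q x" "\<And>x. norm (\<beta>' x) \<le> q x"
    and small: "exp (2 * (\<bar>Re \<mu>\<bar> * r)) * integral {m - r..m + r} q \<le> 1 / 3"
    and r: "0 \<le> r"
  shows "norm (integral {m - r..m + r} (\<lambda>x. f x * cnj (f' x) + g x * cnj (g' x)))
    \<le> 72 * exp (- (\<bar>Re \<mu>\<bar> * r))
       * (sqrt (integral {m - r..m + r} (\<lambda>x. (norm (f x))\<^sup>2 + (norm (g x))\<^sup>2))
        * sqrt (integral {m - r..m + r} (\<lambda>x. (norm (f' x))\<^sup>2 + (norm (g' x))\<^sup>2)))"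
proof -
  define J where "J = {m - r..m + r}"
  define W where "W = max (norm (f m)) (norm (g m))"
  define W' where "W' = max (norm (f' m)) (norm (g' m))"
  define X where "X = integral J (\<lambda>x. (norm (f x))\<^sup>2 + (norm (g x))\<^sup>2)"
  define X' where "X' = integral J (\<lambda>x. (norm (f' x))\<^sup>2 + (norm (g' x))\<^sup>2)"
  define \<kappa> where "\<kappa> = \<bar>Re \<mu>\<bar> * r"
  have W: "norm (f m) \<le> W" "norm (g m) \<le> W" "0 \<le> W"
    and W': "norm (f' m) \<le> W'" "norm (g' m) \<le> W'" "0 \<le> W'"
    by (auto simp: W_def W'_def le_max_iff_disj)
  have small': "exp (2 * (\<bar>Re \<mu>'\<bar> * r)) * integral {m - r..m + r} q \<le> 1 / 3"
    using small opp by simp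
  note near = dirac_solution_near_free[OF sol q(1-3) small W(1,2)]
  note near' = dirac_solution_near_free[OF sol' q(1,4,5) small' W'(1,2)]
  have key: "norm w \<le> exp (Re \<nu> * s) * (3 / 2 * C)"
    if "norm (exp (- \<nu> * of_real s) * w - w0) \<le> C / 2" "norm w0 \<le> C"
    for \<nu> w w0 :: complex and s C :: real
  proof -
    have "norm (exp (- \<nu> * of_real s) * w) \<le> 3 / 2 * C"
      using that norm_triangle_ineq[of "exp (- \<nu> * of_real s) * w - w0" w0] by simp
    then have "exp (- Re \<nu> * s) * norm w \<le> 3 / 2 * C" by (simp add: norm_mult norm_exp_eq_Re)
    then have "exp (Re \<nu> * s) * (exp (- Re \<nu> * s) * norm w) \<le> exp (Re \<nu> * s) * (3 / 2 * C)"
      by (intro mult_left_mono) auto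
    then show ?thesis by (simp add: mult_exp_exp flip: mult.assoc)
  qed
  have pw: "norm (f x * cnj (f' x) + g x * cnj (g' x)) \<le> 9 / 2 * (W * W')" if x: "x \<in> J" for x
  proof -
    define s where "s = x - m"
    have f: "norm (f x) \<le> exp (Re \<mu> * s) * (3 / 2 * W)" "norm (g x) \<le> exp (- Re \<mu> * s) * (3 / 2 * W)"
      using key[of \<mu> s "f x", OF _ W(1)] key[of "- \<mu>" s "g x", OF _ W(2)] near x
      by (simp_all add: J_def s_def)
    have f': "norm (f' x) \<le> exp (- Re \<mu> * s) * (3 / 2 * W')" "norm (g' x) \<le> exp (Re \<mu> * s) * (3 / 2 * W')"
      using key[of \<mu>' s "f' x", OF _ W'(1)] key[of "- \<mu>'" s "g' x", OF _ W'(2)] near' x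
      by (simp_all add: J_def s_def opp)
    have "norm (f x) * norm (f' x) \<le> (exp (Re \<mu> * s) * (3 / 2 * W)) * (exp (- Re \<mu> * s) * (3 / 2 * W'))"
      using f f' W by (intro mult_mono) auto
    also have "\<dots> = (exp (Re \<mu> * s) * exp (- Re \<mu> * s)) * (9 / 4 * (W * W'))" by simp
    also have "\<dots> = 9 / 4 * (W * W')" by (simp add: mult_exp_exp)
    finally have 1: "norm (f x) * norm (f' x) \<le> 9 / 4 * (W * W')" .
    have "norm (g x) * norm (g' x) \<le> (exp (- Re \<mu> * s) * (3 / 2 * W)) * (exp (Re \<mu> * s) * (3 / 2 * W'))"
      using f f' W by (intro mult_mono) auto
    also have "\<dots> = (exp (Re \<mu> * s) * exp (- Re \<mu> * s)) * (9 / 4 * (W * W'))" by simp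
    also have "\<dots> = 9 / 4 * (W * W')" by (simp add: mult_exp_exp)
    finally have 2: "norm (g x) * norm (g' x) \<le> 9 / 4 * (W * W')" .
    have "norm (f x * cnj (f' x) + g x * cnj (g' x)) \<le> norm (f x) * norm (f' x) + norm (g x) * norm (g' x)"
      by (metis complex_mod_cnj norm_mult norm_triangle_ineq)
    then show ?thesis using 1 2 by simp
  qed
  have cont: "continuous_on J (\<lambda>x. f x * cnj (f' x) + g x * cnj (g' x))"
    using dirac_solution_continuous[OF sol] dirac_solution_continuous[OF sol']
    unfolding J_def by (intro continuous_intros)
  have upper: "norm (integral J (\<lambda>x. f x * cnj (f' x) + g x * cnj (g' x))) \<le> 9 * (W * W') * r"
  proof -
    have "norm (integral J (\<lambda>x. f x * cnj (f' x) + g x * cnj (g' x))) \<le> integral J (\<lambda>x. 9 / 2 * (W * W'))"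
      by (rule Henstock_Kurzweil_Integration.integral_norm_bound_integral)
        (use cont pw in \<open>auto simp: J_def intro: integrable_continuous_interval\<close>)
    also have "\<dots> = 9 * (W * W') * r" using r by (simp add: J_def)
    finally show ?thesis .
  qed
  have "(W * W' * r * exp \<kappa> / 8)\<^sup>2 = (W\<^sup>2 * r * exp \<kappa> / 8) * (W'\<^sup>2 * r * exp \<kappa> / 8)"
    by (simp add: power2_eq_square)
  also have "\<dots> \<le> X * X'"
    using dirac_solution_energy_bound[OF sol q(1-3) small r]
      dirac_solution_energy_bound[OF sol' q(1,4,5) small' r] r opp
    unfolding X_def X'_def J_def \<kappa>_def W_def W'_def
    by (intro mult_mono) (auto intro: integral_nonneg_total)
  finally have "W * W' * r * exp \<kappa> / 8 \<le> sqrt (X * X')" by (rule real_le_rsqrt)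
  then have "W * W' * r * exp \<kappa> * (72 * exp (- \<kappa>)) \<le> 8 * sqrt (X * X') * (72 * exp (- \<kappa>))"
    by (intro mult_right_mono) auto
  then have "9 * (W * W') * r * (exp \<kappa> * exp (- \<kappa>)) \<le> 72 * exp (- \<kappa>) * sqrt (X * X')"
    by (simp add: algebra_simps)
  then have "9 * (W * W') * r \<le> 72 * exp (- \<kappa>) * (sqrt X * sqrt X')"
    by (simp add: mult_exp_exp real_sqrt_mult)
  then show ?thesis using upper unfolding X_def X'_def J_def \<kappa>_def by linarith
qed

lemma integral_split_equal_pieces:
  fixes F :: "real \<Rightarrow> 'a::banach"
  assumes "0 \<le> h" "F integrable_on {a..a + real n * h}"
  shows "integral {a..a + real n * h} F = (\<Sum>j<n. integral {a + real j * h..a + real (Suc j) * h} F)"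
  using assms(2)
proof (induction n)
  case 0
  then show ?case by simp
next
  case (Suc n)
  have le: "a \<le> a + real n * h" "a + real n * h \<le> a + real (Suc n) * h"
    using assms(1) by (auto simp: algebra_simps)
  have "F integrable_on {a..a + real n * h}"
    using le by (intro integrable_on_subinterval[OF Suc.prems]) auto
  from Suc.IH[OF this] show ?case
    using Henstock_Kurzweil_Integration.integral_combine[OF le Suc.prems] by simp
qed

text \<open>
  The local constant is the same on every piece, so the Cauchy--Schwarz inequality for sums
  turns the products of local norms into the product of the global norms.
\<close>

lemma dirac_solutions_pairing_partition:
  fixes \<mu> \<mu>' :: complex and h :: real
  assumes sol: "dirac_solution a (a + real n * h) \<mu> \<alpha> \<beta> f g"
    and sol': "dirac_solution a (a + real n * h) \<mu>' \<alpha>' \<beta>' f' g'"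
    and opp: "Re \<mu>' = - Re \<mu>"
    and q: "q integrable_on {a..a + real n * h}"
      "\<And>x. norm (\<alpha> x) \<le> q x" "\<And>x. norm (\<beta> x) \<le> q x"
      "\<And>x. norm (\<alpha>' x) \<le> q x" "\<And>x. norm (\<beta>' x) \<le> q x"
    and small: "\<And>s. \<lbrakk>a \<le> s; s + h \<le> a + real n * h\<rbrakk> \<Longrightarrow>
        exp (\<bar>Re \<mu>\<bar> * h) * integral {s..s + h} q \<le> 1 / 3"
    and h: "0 \<le> h"
  shows "norm (integral {a..a + real n * h} (\<lambda>x. f x * cnj (f' x) + g x * cnj (g' x)))
    \<le> 72 * exp (- (\<bar>Re \<mu>\<bar> * h / 2))
       * (sqrt (integral {a..a + real n * h} (\<lambda>x. (norm (f x))\<^sup>2 + (norm (g x))\<^sup>2))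
        * sqrt (integral {a..a + real n * h} (\<lambda>x. (norm (f' x))\<^sup>2 + (norm (g' x))\<^sup>2)))"
proof -
  define J where "J j = {a + real j * h..a + real (Suc j) * h}" for j
  define X where "X j = integral (J j) (\<lambda>x. (norm (f x))\<^sup>2 + (norm (g x))\<^sup>2)" for j
  define X' where "X' j = integral (J j) (\<lambda>x. (norm (f' x))\<^sup>2 + (norm (g' x))\<^sup>2)" for j
  define I where "I j = integral (J j) (\<lambda>x. f x * cnj (f' x) + g x * cnj (g' x))" for j
  define \<eta> where "\<eta> = 72 * exp (- (\<bar>Re \<mu>\<bar> * h / 2))"
  note cont = dirac_solution_continuous[OF sol] dirac_solution_continuous[OF sol']
  have split: "integral {a..a + real n * h} (\<lambda>x. f x * cnj (f' x) + g x * cnj (g' x)) = (\<Sum>j<n. I j)"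
    "integral {a..a + real n * h} (\<lambda>x. (norm (f x))\<^sup>2 + (norm (g x))\<^sup>2) = (\<Sum>j<n. X j)"
    "integral {a..a + real n * h} (\<lambda>x. (norm (f' x))\<^sup>2 + (norm (g' x))\<^sup>2) = (\<Sum>j<n. X' j)"
    unfolding I_def X_def X'_def J_def
    by (intro integral_split_equal_pieces h integrable_continuous_interval continuous_intros cont)+
  have X0: "0 \<le> X j" "0 \<le> X' j" for j
    unfolding X_def X'_def by (simp_all add: integral_nonneg_total)
  have loc: "norm (I j) \<le> \<eta> * (sqrt (X j) * sqrt (X' j))" if j: "j < n" for j
  proof -
    define m where "m = a + real j * h + h / 2"
    have Jm: "J j = {m - h / 2..m + h / 2}" by (simp add: J_def m_def algebra_simps)
    have "real (Suc j) * h \<le> real n * h" using j h by (intro mult_right_mono) auto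
    then have sub: "a \<le> m - h / 2" "m + h / 2 \<le> a + real n * h"
      using h by (auto simp: m_def algebra_simps)
    have "q integrable_on {m - h / 2..m + h / 2}"
      using sub by (intro integrable_on_subinterval[OF q(1)]) auto
    moreover have "exp (2 * (\<bar>Re \<mu>\<bar> * (h / 2))) * integral {m - h / 2..m + h / 2} q \<le> 1 / 3"
      using small[of "m - h / 2"] sub by (simp add: field_simps)
    ultimately show ?thesis
      using dirac_solutions_local_pairing[OF dirac_solution_subinterval[OF sol sub]
          dirac_solution_subinterval[OF sol' sub] opp _ q(2-5)] h
      unfolding I_def X_def X'_def Jm \<eta>_def by simp
  qed
  have "norm (\<Sum>j<n. I j) \<le> (\<Sum>j<n. \<eta> * (sqrt (X j) * sqrt (X' j)))"
    using loc by (intro sum_norm_le) auto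
  also have "\<dots> = \<eta> * (\<Sum>j<n. \<bar>sqrt (X j)\<bar> * \<bar>sqrt (X' j)\<bar>)"
    using X0 by (simp add: sum_distrib_left)
  also have "\<dots> \<le> \<eta> * (L2_set (\<lambda>j. sqrt (X j)) {..<n} * L2_set (\<lambda>j. sqrt (X' j)) {..<n})"
    by (intro mult_left_mono L2_set_mult_ineq) (simp add: \<eta>_def)
  also have "\<dots> = \<eta> * (sqrt (\<Sum>j<n. X j) * sqrt (\<Sum>j<n. X' j))"
    using X0 by (simp add: L2_set_def)
  finally show ?thesis unfolding split \<eta>_def .
qed

lemma integral_small_intervals:
  fixes q :: "real \<Rightarrow> real"
  assumes "q integrable_on {a..b}" "e > 0"
  obtains d where "d > 0" "\<And>s t. \<lbrakk>a \<le> s; s \<le> t; t \<le> b; t - s < d\<rbrakk> \<Longrightarrow> integral {s..t} q < e"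
proof -
  have "uniformly_continuous_on {a..b} (\<lambda>x. integral {a..x} q)"
    using indefinite_integral_continuous_1[OF assms(1)] by (intro compact_uniformly_continuous) auto
  then obtain d where d: "d > 0" "\<And>s t. \<lbrakk>s \<in> {a..b}; t \<in> {a..b}; dist t s < d\<rbrakk> \<Longrightarrow>
      dist (integral {a..t} q) (integral {a..s} q) < e"
    using assms(2) unfolding uniformly_continuous_on_def by metis
  show ?thesis
  proof (rule that[OF d(1)])
    fix s t assume st: "a \<le> s" "s \<le> t" "t \<le> b" "t - s < d"
    have "q integrable_on {a..t}" using st by (intro integrable_on_subinterval[OF assms(1)]) auto
    from Henstock_Kurzweil_Integration.integral_combine[OF st(1,2) this]
    have "integral {s..t} q = integral {a..t} q - integral {a..s} q" by simp
    then show "integral {s..t} q < e" using d(2)[of s t] st by (auto simp: dist_real_def)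
  qed
qed

text \<open>
  Since \<open>C\<close> is arbitrary, the pairing of two solutions becomes negligible against the product
  of their norms, uniformly over all couplings dominated by \<open>q\<close> and all large growth rates.
\<close>

theorem dirac_solutions_norm_product_large:
  fixes a b C :: real and q :: "real \<Rightarrow> real"
  assumes ab: "a < b" and q: "q integrable_on {a..b}"
  obtains T where "\<And>\<mu> \<mu>' \<alpha> \<beta> \<alpha>' \<beta>' f g f' g'.
    \<lbrakk>dirac_solution a b \<mu> \<alpha> \<beta> f g; dirac_solution a b \<mu>' \<alpha>' \<beta>' f' g';
     Re \<mu>' = - Re \<mu>; \<bar>Re \<mu>\<bar> \<ge> T;
     \<And>x. norm (\<alpha> x) \<le> q x; \<And>x. norm (\<beta> x) \<le> q x;
     \<And>x. norm (\<alpha>' x) \<le> q x; \<And>x. norm (\<beta>' x) \<le> q x\<rbrakk> \<Longrightarrow>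
    C * norm (integral {a..b} (\<lambda>x. f x * cnj (f' x) + g x * cnj (g' x)))
    \<le> sqrt (integral {a..b} (\<lambda>x. (norm (f x))\<^sup>2 + (norm (g x))\<^sup>2))
        * sqrt (integral {a..b} (\<lambda>x. (norm (f' x))\<^sup>2 + (norm (g' x))\<^sup>2))"
proof -
  obtain K :: real where K: "K > 0" "72 * C \<le> exp K"
  proof
    show "\<bar>72 * C\<bar> + 1 > 0" by simp
    show "72 * C \<le> exp (\<bar>72 * C\<bar> + 1)" using exp_ge_add_one_self[of "\<bar>72 * C\<bar> + 1"] by simp
  qed
  obtain d where d: "d > 0" "\<And>s t. \<lbrakk>a \<le> s; s \<le> t; t \<le> b; t - s < d\<rbrakk> \<Longrightarrow> integral {s..t} q < exp (- 4 * K) / 3"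
    using integral_small_intervals[OF q, of "exp (- 4 * K) / 3"] by auto
  define T where "T = 2 * K / (b - a) + 4 * K / d + 1"
  show ?thesis
  proof (rule that[of T])
    fix \<mu> \<mu>' \<alpha> \<beta> \<alpha>' \<beta>' f g f' g'
    assume sol: "dirac_solution a b \<mu> \<alpha> \<beta> f g" "dirac_solution a b \<mu>' \<alpha>' \<beta>' f' g'"
      and opp: "Re \<mu>' = - Re \<mu>" and T: "\<bar>Re \<mu>\<bar> \<ge> T"
      and bds: "\<And>x. norm (\<alpha> x) \<le> q x" "\<And>x. norm (\<beta> x) \<le> q x"
        "\<And>x. norm (\<alpha>' x) \<le> q x" "\<And>x. norm (\<beta>' x) \<le> q x"
    \<comment> \<open>The number of pieces is chosen so that \<open>2 * K \<le> \<tau> * h < 4 * K\<close> for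
      the length \<open>h\<close> of a piece: the lower bound yields the gain \<open>exp K\<close>, the upper
      bound keeps the perturbation factor below \<open>exp (4 * K)\<close>.\<close>
    define \<tau> where "\<tau> = \<bar>Re \<mu>\<bar>"
    define n where "n = nat \<lfloor>\<tau> * (b - a) / (2 * K)\<rfloor>"
    define h where "h = (b - a) / real n"
    have pos: "2 * K / (b - a) > 0" "4 * K / d > 0" using K d ab by auto
    then have \<tau>: "\<tau> > 0" "\<tau> > 2 * K / (b - a)" "\<tau> > 4 * K / d"
      using T unfolding T_def \<tau>_def by linarith+
    have "\<tau> * (b - a) / (2 * K) \<ge> 1" using \<tau>(2) ab K by (simp add: field_simps)
    then have n: "n \<ge> 1" "real n \<le> \<tau> * (b - a) / (2 * K)" "\<tau> * (b - a) / (2 * K) < real n + 1"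
      unfolding n_def using \<tau>(1) ab K by (auto simp: le_nat_iff le_floor_iff)
    have nh: "a + real n * h = b" using n(1) by (simp add: h_def)
    have h0: "h > 0" using n(1) ab by (simp add: h_def)
    have low: "2 * K \<le> \<tau> * h" using n(1,2) K by (simp add: h_def field_simps)
    have "\<tau> * (b - a) / (2 * K) < 2 * real n" using n by linarith
    then have high: "\<tau> * h < 4 * K" using n(1) K by (simp add: h_def field_simps)
    have "h < 4 * K / \<tau>" using high \<tau>(1) by (simp add: field_simps)
    also have "\<dots> < d" using \<tau>(1,3) d(1) by (simp add: field_simps)
    finally have hd: "h < d" .
    have small: "exp (\<bar>Re \<mu>\<bar> * h) * integral {s..s + h} q \<le> 1 / 3" if s: "a \<le> s" "s + h \<le> a + real n * h" for s
    proof -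
      have "integral {s..s + h} q \<le> exp (- 4 * K) / 3" using d(2)[of s "s + h"] s h0 hd nh by auto
      then have "exp (\<bar>Re \<mu>\<bar> * h) * integral {s..s + h} q \<le> exp (\<bar>Re \<mu>\<bar> * h) * (exp (- 4 * K) / 3)"
        by (intro mult_left_mono) auto
      also have "\<dots> = exp (\<tau> * h - 4 * K) / 3" by (simp add: \<tau>_def mult_exp_exp)
      also have "\<dots> \<le> 1 / 3" using high by simp
      finally show ?thesis .
    qed
    define Y where "Y = norm (integral {a..b} (\<lambda>x. f x * cnj (f' x) + g x * cnj (g' x)))"
    define Z where "Z = sqrt (integral {a..b} (\<lambda>x. (norm (f x))\<^sup>2 + (norm (g x))\<^sup>2))
        * sqrt (integral {a..b} (\<lambda>x. (norm (f' x))\<^sup>2 + (norm (g' x))\<^sup>2))"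
    have Z0: "Z \<ge> 0" unfolding Z_def by (simp add: integral_nonneg_total)
    have "Y \<le> 72 * exp (- (\<bar>Re \<mu>\<bar> * h / 2)) * Z"
      using dirac_solutions_pairing_partition[of a n h \<mu> \<alpha> \<beta> f g \<mu>' \<alpha>' \<beta>' f' g' q, unfolded nh,
          OF sol opp q bds small] h0 nh
      unfolding Y_def Z_def by simp
    also have "\<dots> \<le> 72 * exp (- K) * Z"
      using low Z0 by (intro mult_right_mono mult_left_mono) (auto simp: \<tau>_def)
    finally have "exp K * Y \<le> exp K * (72 * exp (- K) * Z)" by (intro mult_left_mono) auto
    also have "\<dots> = 72 * Z" by (simp add: exp_minus)
    finally have "exp K * Y \<le> 72 * Z" .
    moreover have "72 * C * Y \<le> exp K * Y" using K(2) by (intro mult_right_mono) (auto simp: Y_def)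
    ultimately have "C * Y \<le> Z" by simp
    then show "C * norm (integral {a..b} (\<lambda>x. f x * cnj (f' x) + g x * cnj (g' x)))
      \<le> sqrt (integral {a..b} (\<lambda>x. (norm (f x))\<^sup>2 + (norm (g x))\<^sup>2))
        * sqrt (integral {a..b} (\<lambda>x. (norm (f' x))\<^sup>2 + (norm (g' x))\<^sup>2))"
      unfolding Y_def Z_def .
  qed
qed

section \<open>The space of square integrable vector functions\<close>

lemma integral_Cauchy_Schwarz:
  fixes f g :: "'a \<Rightarrow> real"
  assumes [measurable]: "f \<in> borel_measurable M" "g \<in> borel_measurable M"
    and f2: "integrable M (\<lambda>x. (f x)\<^sup>2)" and g2: "integrable M (\<lambda>x. (g x)\<^sup>2)"
    and pos: "\<And>x. 0 \<le> f x" "\<And>x. 0 \<le> g x"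
  shows "integrable M (\<lambda>x. f x * g x)"
    and "(LINT x|M. f x * g x) \<le> sqrt (LINT x|M. (f x)\<^sup>2) * sqrt (LINT x|M. (g x)\<^sup>2)"
proof -
  show int: "integrable M (\<lambda>x. f x * g x)"
  proof (rule Bochner_Integration.integrable_bound[OF Bochner_Integration.integrable_add[OF f2 g2]])
    show "AE x in M. norm (f x * g x) \<le> norm ((f x)\<^sup>2 + (g x)\<^sup>2)"
    proof (rule AE_I2)
      fix x
      have "0 \<le> (f x - g x)\<^sup>2" "0 \<le> f x * g x" using pos by auto
      then show "norm (f x * g x) \<le> norm ((f x)\<^sup>2 + (g x)\<^sup>2)"
        by (simp add: power2_eq_square algebra_simps)
    qed
  qed measurable
  have "(\<integral>\<^sup>+x. ennreal (f x) * ennreal (g x) \<partial>M)\<^sup>2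
      \<le> (\<integral>\<^sup>+x. (ennreal (f x))\<^sup>2 \<partial>M) * (\<integral>\<^sup>+x. (ennreal (g x))\<^sup>2 \<partial>M)"
    by (rule Cauchy_Schwarz_nn_integral) auto
  then have "(ennreal (LINT x|M. f x * g x))\<^sup>2 \<le> ennreal (LINT x|M. (f x)\<^sup>2) * ennreal (LINT x|M. (g x)\<^sup>2)"
    using nn_integral_eq_integral[OF int] nn_integral_eq_integral[OF f2] nn_integral_eq_integral[OF g2] pos
    by (simp add: ennreal_power flip: ennreal_mult)
  then have "(LINT x|M. f x * g x)\<^sup>2 \<le> (LINT x|M. (f x)\<^sup>2) * (LINT x|M. (g x)\<^sup>2)"
    using pos by (simp add: ennreal_power flip: ennreal_mult)
  then show "(LINT x|M. f x * g x) \<le> sqrt (LINT x|M. (f x)\<^sup>2) * sqrt (LINT x|M. (g x)\<^sup>2)"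
    by (metis real_le_rsqrt real_sqrt_mult)
qed

text \<open>
  The Hermitian inner product of two vectors, the integrand of \<open>H_inner\<close>. The \<open>\<bullet>\<close> on this type
  is only its real part.
\<close>

definition cdot :: "complex^2 \<Rightarrow> complex^2 \<Rightarrow> complex"
  where "cdot u v = u $ 1 * cnj (v $ 1) + u $ 2 * cnj (v $ 2)"

lemma norm_complex2_sq: "(norm (u :: complex^2))\<^sup>2 = (norm (u $ 1))\<^sup>2 + (norm (u $ 2))\<^sup>2"
  by (simp add: norm_vec_def L2_set_def sum_2)

lemma cdot_self: "cdot u u = of_real ((norm u)\<^sup>2)"
  unfolding norm_complex2_sq cdot_def of_real_add complex_norm_square ..

lemma norm_cdot_le: "norm (cdot u v) \<le> norm u * norm v"
proof -
  have "norm (cdot u v) \<le> (\<Sum>i\<in>UNIV. \<bar>norm (u $ i)\<bar> * \<bar>norm (v $ i)\<bar>)"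
    unfolding cdot_def sum_2 by (simp add: norm_triangle_mono norm_mult)
  also have "\<dots> \<le> norm u * norm v"
    unfolding norm_vec_def by (rule L2_set_mult_ineq)
  finally show ?thesis .
qed

lemma bounded_linear_cdot: "bounded_linear (\<lambda>u. cdot u v)"
  by (rule bounded_linear_intro[OF _ _ norm_cdot_le])
    (simp_all add: cdot_def algebra_simps)

lemma cdot_scale: "cdot (c *s u) v = c * cdot u v"
  by (simp add: cdot_def algebra_simps)

lemma norm_scale_complex2: "norm (c *s (u :: complex^2)) = norm c * norm u"
proof -
  have "(norm (c *s u))\<^sup>2 = (norm c * norm u)\<^sup>2"
    unfolding norm_complex2_sq power_mult_distrib by (simp add: norm_mult power_mult_distrib algebra_simps)
  then show ?thesis by simp
qed

lemma H_inner_cdot: "H_inner f g = (LINT x|leb_0_pi. cdot (f x) (g x))"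
  by (simp add: H_inner_def cdot_def)

lemma H_norm_integral: "H_norm f = sqrt (LINT x|leb_0_pi. (norm (f x))\<^sup>2)"
  unfolding H_norm_def H_inner_cdot cdot_self integral_complex_of_real by simp

lemma H_norm_nonneg: "0 \<le> H_norm f"
  unfolding H_norm_integral by simp

lemma H_norm_sq: "(H_norm f)\<^sup>2 = (LINT x|leb_0_pi. (norm (f x))\<^sup>2)"
  unfolding H_norm_integral by simp

lemma H_spaceD:
  assumes "f \<in> H_space"
  shows "f \<in> borel_measurable leb_0_pi" "integrable leb_0_pi (\<lambda>x. (norm (f x))\<^sup>2)"
  using assms by (auto simp: H_space_def)

lemma cdot_measurable [measurable]:
  assumes [measurable]: "f \<in> borel_measurable M" "g \<in> borel_measurable M"
  shows "(\<lambda>x. cdot (f x) (g x)) \<in> borel_measurable M"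
proof -
  have "(\<lambda>x. f x $ i) \<in> borel_measurable M" "(\<lambda>x. g x $ i) \<in> borel_measurable M" for i
    by (rule borel_measurable_continuous_on[OF _ assms(1)], intro continuous_intros)
       (rule borel_measurable_continuous_on[OF _ assms(2)], intro continuous_intros)
  then have "(\<lambda>x. f x $ i * cnj (g x $ i)) \<in> borel_measurable M" for i
    by (intro borel_measurable_times borel_measurable_continuous_on[of cnj] continuous_intros)
  then show ?thesis unfolding cdot_def by (intro borel_measurable_add)
qed

lemma H_norm_product_integral:
  assumes "f \<in> H_space" "g \<in> H_space"
  shows "integrable leb_0_pi (\<lambda>x. norm (f x) * norm (g x))"
    and "(LINT x|leb_0_pi. norm (f x) * norm (g x)) \<le> H_norm f * H_norm g"
  using integral_Cauchy_Schwarz[of "\<lambda>x. norm (f x)" leb_0_pi "\<lambda>x. norm (g x)"] H_spaceD[OF assms(1)] H_spaceD[OF assms(2)]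
  unfolding H_norm_integral by simp_all

lemma H_inner_integrable:
  assumes "f \<in> H_space" "g \<in> H_space"
  shows "integrable leb_0_pi (\<lambda>x. cdot (f x) (g x))"
proof (rule Bochner_Integration.integrable_bound[OF H_norm_product_integral(1)[OF assms]])
  show "(\<lambda>x. cdot (f x) (g x)) \<in> borel_measurable leb_0_pi"
    using H_spaceD(1)[OF assms(1)] H_spaceD(1)[OF assms(2)] by measurable
  show "AE x in leb_0_pi. norm (cdot (f x) (g x)) \<le> norm (norm (f x) * norm (g x))"
    using norm_cdot_le by simp
qed

lemma H_inner_Cauchy_Schwarz:
  assumes "f \<in> H_space" "g \<in> H_space"
  shows "norm (H_inner f g) \<le> H_norm f * H_norm g"
proof -
  have "norm (H_inner f g) \<le> (LINT x|leb_0_pi. norm (f x) * norm (g x))"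
    unfolding H_inner_cdot
    by (rule Bochner_Integration.integral_norm_bound_integral[OF H_inner_integrable[OF assms] H_norm_product_integral(1)[OF assms]])
      (rule norm_cdot_le)
  then show ?thesis using H_norm_product_integral(2)[OF assms] by linarith
qed

lemma H_space_scale:
  assumes "f \<in> H_space"
  shows "(\<lambda>x. c *s f x) \<in> H_space"
proof -
  have "continuous_on UNIV (\<lambda>u :: complex^2. c *s u)"
    by (intro linear_continuous_on bounded_linear_intro[of _ "norm c"])
      (simp_all add: norm_scale_complex2 vector_add_ldistrib mult.commute vec_eq_iff scaleR_conv_of_real mult.left_commute)
  then have "(\<lambda>x. c *s f x) \<in> borel_measurable leb_0_pi"
    using H_spaceD(1)[OF assms] by (rule borel_measurable_continuous_on)
  then show ?thesis
    using H_spaceD(2)[OF assms] by (simp add: H_space_def norm_scale_complex2 power_mult_distrib)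
qed

lemma H_norm_scale: "H_norm (\<lambda>x. c *s f x) = norm c * H_norm f"
  unfolding H_norm_integral by (simp add: norm_scale_complex2 power_mult_distrib real_sqrt_mult)

lemma norm_add_sq_le: "(norm (u + v))\<^sup>2 \<le> 2 * (norm u)\<^sup>2 + 2 * (norm v)\<^sup>2"
  for u v :: "'a::real_normed_vector"
proof -
  have "(norm (u + v))\<^sup>2 \<le> (norm u + norm v)\<^sup>2" by (intro power_mono norm_triangle_ineq) auto
  also have "\<dots> = 2 * (norm u)\<^sup>2 + 2 * (norm v)\<^sup>2 - (norm u - norm v)\<^sup>2"
    by (simp add: power2_eq_square algebra_simps)
  also have "\<dots> \<le> 2 * (norm u)\<^sup>2 + 2 * (norm v)\<^sup>2" by simp
  finally show ?thesis .
qed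

lemma H_space_add:
  assumes "f \<in> H_space" "g \<in> H_space"
  shows "(\<lambda>x. f x + g x) \<in> H_space"
    and "(H_norm (\<lambda>x. f x + g x))\<^sup>2 \<le> 2 * (H_norm f)\<^sup>2 + 2 * (H_norm g)\<^sup>2"
proof -
  have meas: "(\<lambda>x. f x + g x) \<in> borel_measurable leb_0_pi"
    using H_spaceD(1)[OF assms(1)] H_spaceD(1)[OF assms(2)] by measurable
  have int: "integrable leb_0_pi (\<lambda>x. 2 * (norm (f x))\<^sup>2 + 2 * (norm (g x))\<^sup>2)"
    using H_spaceD(2)[OF assms(1)] H_spaceD(2)[OF assms(2)] by auto
  have i2: "integrable leb_0_pi (\<lambda>x. (norm (f x + g x))\<^sup>2)"
  proof (rule Bochner_Integration.integrable_bound[OF int])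
    show "(\<lambda>x. (norm (f x + g x))\<^sup>2) \<in> borel_measurable leb_0_pi"
      using meas by measurable
    show "AE x in leb_0_pi. norm ((norm (f x + g x))\<^sup>2) \<le> norm (2 * (norm (f x))\<^sup>2 + 2 * (norm (g x))\<^sup>2)"
      using norm_add_sq_le by (intro AE_I2) simp
  qed
  then show "(\<lambda>x. f x + g x) \<in> H_space" using meas by (simp add: H_space_def)
  have "(LINT x|leb_0_pi. (norm (f x + g x))\<^sup>2) \<le> (LINT x|leb_0_pi. 2 * (norm (f x))\<^sup>2 + 2 * (norm (g x))\<^sup>2)"
    by (intro Bochner_Integration.integral_mono i2 int norm_add_sq_le)
  also have "\<dots> = 2 * (H_norm f)\<^sup>2 + 2 * (H_norm g)\<^sup>2"
    unfolding H_norm_sq using H_spaceD(2)[OF assms(1)] H_spaceD(2)[OF assms(2)] by simp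
  finally show "(H_norm (\<lambda>x. f x + g x))\<^sup>2 \<le> 2 * (H_norm f)\<^sup>2 + 2 * (H_norm g)\<^sup>2"
    unfolding H_norm_sq .
qed

lemma H_space_diff:
  assumes "f \<in> H_space" "g \<in> H_space"
  shows "(\<lambda>x. f x - g x) \<in> H_space"
    and "(H_norm (\<lambda>x. f x - g x))\<^sup>2 \<le> 2 * (H_norm f)\<^sup>2 + 2 * (H_norm g)\<^sup>2"
  using H_space_add[OF assms(1) H_space_scale[OF assms(2), of "-1"]] H_norm_scale[of "-1" g]
  by simp_all

lemma lin_comb_H_space:
  assumes "\<And>n. y n \<in> H_space" "finite A"
  shows "lin_comb c y A \<in> H_space"
  using assms(2)
proof induction
  case empty
  then show ?case by (simp add: lin_comb_def H_space_def)
next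
  case (insert k A)
  then show ?case
    using H_space_add(1)[OF H_space_scale[OF assms(1)[of k], of "c k"] insert.IH]
    by (simp add: lin_comb_def)
qed

lemma H_inner_diff_left:
  assumes "f \<in> H_space" "g \<in> H_space" "h \<in> H_space"
  shows "H_inner (\<lambda>x. f x - g x) h = H_inner f h - H_inner g h"
  using H_inner_integrable[OF assms(1,3)] H_inner_integrable[OF assms(2,3)]
  unfolding H_inner_cdot by (simp add: linear_diff[OF bounded_linear.linear[OF bounded_linear_cdot]])

lemma H_inner_lin_comb:
  assumes "\<And>n. y n \<in> H_space" "h \<in> H_space"
  shows "H_inner (lin_comb c y A) h = (\<Sum>k\<in>A. c k * H_inner (y k) h)"
  using H_inner_integrable[OF assms]
  unfolding H_inner_cdot lin_comb_def
  by (simp add: linear_sum[OF bounded_linear.linear[OF bounded_linear_cdot]] cdot_scale)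

text \<open>
  By continuity of the inner product, the coefficients of the expansion of \<open>f\<close> are
  \<open>H_inner f (z n)\<close>, and the terms of a convergent series tend to zero.
\<close>

lemma schauder_basis_biorthogonal_terms_vanish:
  assumes basis: "schauder_basis y"
    and z: "\<And>n. z n \<in> H_space"
    and bi: "\<And>n k. H_inner (y n) (z k) = (if n = k then 1 else 0)"
    and f: "f \<in> H_space"
  shows "(\<lambda>n. norm (H_inner f (z n)) * H_norm (y n)) \<longlonglongrightarrow> 0"
proof -
  have y: "y n \<in> H_space" for n using basis by (simp add: schauder_basis_def)
  obtain c where c: "(\<lambda>N. H_norm (\<lambda>x. f x - lin_comb c y {..<N} x)) \<longlonglongrightarrow> 0"
    using basis f unfolding schauder_basis_def by blast
  define R where "R N = (\<lambda>x. f x - lin_comb c y {..<N} x)" for N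
  have RH: "R N \<in> H_space" for N
    unfolding R_def by (intro H_space_diff f lin_comb_H_space y finite_lessThan)
  have cn: "c n = H_inner f (z n)" for n
  proof -
    have "norm (H_inner f (z n) - c n) \<le> H_norm (R N) * H_norm (z n)" if "N > n" for N
    proof -
      have "H_inner (lin_comb c y {..<N}) (z n) = c n"
        using that by (simp add: H_inner_lin_comb[OF y z] bi if_distrib cong: if_cong)
      then have "H_inner (R N) (z n) = H_inner f (z n) - c n"
        unfolding R_def by (subst H_inner_diff_left[OF f lin_comb_H_space[OF y] z]) auto
      then show ?thesis using H_inner_Cauchy_Schwarz[OF RH z] by metis
    qed
    then have "\<forall>\<^sub>F N in sequentially. norm (H_inner f (z n) - c n) \<le> H_norm (R N) * H_norm (z n)"
      using eventually_gt_at_top[of n] by (rule eventually_mono[rotated])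
    moreover have "(\<lambda>N. H_norm (R N) * H_norm (z n)) \<longlonglongrightarrow> 0"
      using tendsto_mult_right[OF c] unfolding R_def by simp
    ultimately have "norm (H_inner f (z n) - c n) \<le> 0"
      using tendsto_lowerbound[of _ 0 sequentially] by (metis sequentially_bot)
    then show ?thesis by simp
  qed
  have bound: "(norm (c n) * H_norm (y n))\<^sup>2 \<le> 2 * (H_norm (R n))\<^sup>2 + 2 * (H_norm (R (Suc n)))\<^sup>2" for n
  proof -
    have "(\<lambda>x. c n *s y n x) = (\<lambda>x. R n x - R (Suc n) x)"
      by (simp add: R_def lin_comb_def fun_eq_iff)
    then show ?thesis
      using H_space_diff(2)[OF RH[of n] RH[of "Suc n"]] H_norm_scale[of "c n" "y n"] by simp
  qed
  have R0: "(\<lambda>n. H_norm (R n)) \<longlonglongrightarrow> 0" using c unfolding R_def .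
  have lim: "(\<lambda>n. 2 * (H_norm (R n))\<^sup>2 + 2 * (H_norm (R (Suc n)))\<^sup>2) \<longlonglongrightarrow> 2 * 0\<^sup>2 + 2 * 0\<^sup>2"
    by (intro tendsto_add tendsto_mult tendsto_power tendsto_const R0 LIMSEQ_Suc[OF R0])
  have "(\<lambda>n. (norm (c n) * H_norm (y n))\<^sup>2) \<longlonglongrightarrow> 2 * 0\<^sup>2 + 2 * 0\<^sup>2"
  proof (rule tendsto_sandwich[OF _ _ _ lim])
    show "\<forall>\<^sub>F n in sequentially. 0 \<le> (norm (c n) * H_norm (y n))\<^sup>2" by simp
    show "\<forall>\<^sub>F n in sequentially. (norm (c n) * H_norm (y n))\<^sup>2
        \<le> 2 * (H_norm (R n))\<^sup>2 + 2 * (H_norm (R (Suc n)))\<^sup>2" using bound by simp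
  qed simp
  then show ?thesis unfolding cn by simp
qed

section \<open>Uniform boundedness for biorthogonal systems\<close>

text \<open>
  Of the two vectors \<open>S + a k k\<close> and \<open>S - a k k\<close>, whose difference is \<open>2 *\<^sub>R a k k\<close>, one is at
  least as long as \<open>a k k\<close>. The signs are chosen one after another on this basis, with \<open>S\<close> the
  signed sum over the indices below \<open>k\<close>.
\<close>

lemma exists_signs_diagonal_dominated:
  fixes a :: "nat \<Rightarrow> nat \<Rightarrow> 'a::real_normed_vector"
  obtains s :: "nat \<Rightarrow> real" where "\<And>k. \<bar>s k\<bar> = 1"
    "\<And>k. norm (a k k) \<le> norm (\<Sum>j\<le>k. s j *\<^sub>R a j k)"
proof -
  define good where "good s k r \<longleftrightarrow> \<bar>r\<bar> = 1 \<and> norm (a k k) \<le> norm ((\<Sum>j<k. s j *\<^sub>R a j k) + r *\<^sub>R a k k)"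
    for s :: "nat \<Rightarrow> real" and k and r :: real
  have "\<exists>s. \<forall>k. good s k (s k)"
  proof (rule dependent_wf_choice)
    show "wf less_than" by (rule wf_less_than)
    show "good f x r = good g x r" if "\<And>z. (z, x) \<in> less_than \<Longrightarrow> f z = g z" for f g x r
      using that unfolding good_def by (simp cong: sum.cong_simp)
    show "\<exists>r. good f x r" for x f
    proof -
      define S where "S = (\<Sum>j<x. f j *\<^sub>R a j x)"
      have "2 * norm (a x x) = norm ((S + a x x) - (S - a x x))"
        by (simp flip: scaleR_2)
      also have "\<dots> \<le> norm (S + a x x) + norm (S - a x x)" by (rule norm_triangle_ineq4)
      finally have "norm (a x x) \<le> norm (S + 1 *\<^sub>R a x x) \<or> norm (a x x) \<le> norm (S + (-1) *\<^sub>R a x x)"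
        by simp linarith
      then show ?thesis unfolding good_def S_def[symmetric] by (metis abs_1 abs_minus_cancel)
    qed
  qed
  then obtain s where "\<And>k. good s k (s k)" by blast
  then show ?thesis using that[of s] by (simp add: good_def sum.lessThan_Suc flip: lessThan_Suc_atMost)
qed

lemma suminf_weighted_Cauchy_Schwarz:
  fixes w a :: "nat \<Rightarrow> real"
  assumes w: "\<And>j. 0 \<le> w j" "summable w" and a: "\<And>j. 0 \<le> a j"
    and wa2: "summable (\<lambda>j. w j * (a j)\<^sup>2)"
  shows "summable (\<lambda>j. w j * a j)"
    and "(\<Sum>j. w j * a j)\<^sup>2 \<le> (\<Sum>j. w j) * (\<Sum>j. w j * (a j)\<^sup>2)"
proof -
  show wa: "summable (\<lambda>j. w j * a j)"
  proof (rule summable_comparison_test'[OF summable_add[OF w(2) wa2]])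
    fix j :: nat
    have "0 \<le> (a j - 1)\<^sup>2" "0 \<le> a j" using a by auto
    then have "a j \<le> 1 + (a j)\<^sup>2" by (simp add: power2_eq_square algebra_simps)
    then have "w j * a j \<le> w j * (1 + (a j)\<^sup>2)" using w(1) by (rule mult_left_mono)
    then show "norm (w j * a j) \<le> w j + w j * (a j)\<^sup>2" using w(1) a by (simp add: algebra_simps)
  qed
  show "(\<Sum>j. w j * a j)\<^sup>2 \<le> (\<Sum>j. w j) * (\<Sum>j. w j * (a j)\<^sup>2)"
  proof (rule LIMSEQ_le)
    show "(\<lambda>n. (\<Sum>j<n. w j * a j)\<^sup>2) \<longlonglongrightarrow> (\<Sum>j. w j * a j)\<^sup>2"
      by (intro tendsto_power summable_LIMSEQ wa)
    show "(\<lambda>n. (\<Sum>j<n. w j) * (\<Sum>j<n. w j * (a j)\<^sup>2)) \<longlonglongrightarrow> (\<Sum>j. w j) * (\<Sum>j. w j * (a j)\<^sup>2)"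
      by (intro tendsto_mult summable_LIMSEQ w wa2)
    have "(\<Sum>j<n. w j * a j)\<^sup>2 \<le> (\<Sum>j<n. w j) * (\<Sum>j<n. w j * (a j)\<^sup>2)" for n
      using Cauchy_Schwarz_ineq_sum[of "\<lambda>j. sqrt (w j)" "\<lambda>j. sqrt (w j) * a j" "{..<n}"] w(1)
      by (simp add: power_mult_distrib flip: mult.assoc)
    then show "\<exists>N. \<forall>n\<ge>N. (\<Sum>j<n. w j * a j)\<^sup>2 \<le> (\<Sum>j<n. w j) * (\<Sum>j<n. w j * (a j)\<^sup>2)"
      by blast
  qed
qed

text \<open>
  Completeness of \<open>H_space\<close> in the form needed for the gliding hump: an absolutely convergent
  series of unit vectors has a pointwise sum that lies in \<open>H_space\<close> and may be paired with \<open>h\<close>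
  term by term. The weighted sum of \<open>(norm (g j x))\<^sup>2\<close> has a finite integral, hence is finite
  almost everywhere, and by the weighted Cauchy--Schwarz inequality it dominates
  \<open>(norm (f x))\<^sup>2\<close> up to a constant.
\<close>

lemma H_series_converges:
  assumes g: "\<And>j. g j \<in> H_space" "\<And>j. H_norm (g j) = 1"
    and w: "\<And>j. 0 \<le> w j" "summable w" and c: "\<And>j. \<bar>c j\<bar> \<le> w j"
  defines "f \<equiv> (\<lambda>x. \<Sum>j. c j *\<^sub>R g j x)"
  shows "f \<in> H_space"
    and "h \<in> H_space \<Longrightarrow> (\<lambda>j. c j *\<^sub>R H_inner (g j) h) sums H_inner f h"
proof -
  note gm [measurable] = H_spaceD(1)[OF g(1)]
  have int1: "(LINT x|leb_0_pi. (norm (g j x))\<^sup>2) = 1" for j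
    using g(2)[of j] unfolding H_norm_integral by simp
  have intw: "integrable leb_0_pi (\<lambda>x. w j * (norm (g j x))\<^sup>2)" for j
    using H_spaceD(2)[OF g(1)] by simp
  have "(\<integral>\<^sup>+x. (\<Sum>j. ennreal (w j * (norm (g j x))\<^sup>2)) \<partial>leb_0_pi)
        = (\<Sum>j. \<integral>\<^sup>+x. ennreal (w j * (norm (g j x))\<^sup>2) \<partial>leb_0_pi)"
    by (rule nn_integral_suminf) measurable
  also have "\<dots> = (\<Sum>j. ennreal (w j))"
    using w(1) by (subst nn_integral_eq_integral[OF intw]) (auto simp: int1)
  also have "\<dots> \<noteq> \<infinity>" using w ennreal_suminf_neq_top by auto
  finally have fin: "(\<integral>\<^sup>+x. (\<Sum>j. ennreal (w j * (norm (g j x))\<^sup>2)) \<partial>leb_0_pi) \<noteq> \<infinity>" .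
  have "AE x in leb_0_pi. (\<Sum>j. ennreal (w j * (norm (g j x))\<^sup>2)) \<noteq> \<infinity>"
    by (rule nn_integral_PInf_AE[OF _ fin]) measurable
  then have ae: "AE x in leb_0_pi. summable (\<lambda>j. w j * (norm (g j x))\<^sup>2)"
    by eventually_elim (auto intro!: summable_suminf_not_top simp: w(1))
  define G where "G x = (\<Sum>j. w j * (norm (g j x))\<^sup>2)" for x
  have G: "integrable leb_0_pi G"
    unfolding G_def
  proof (rule integrable_suminf[OF intw])
    show "AE x in leb_0_pi. summable (\<lambda>j. norm (w j * (norm (g j x))\<^sup>2))"
      using ae w(1) by simp
    show "summable (\<lambda>j. LINT x|leb_0_pi. norm (w j * (norm (g j x))\<^sup>2))"
      using w by (simp add: int1)
  qed
  have cle: "norm (c j *\<^sub>R g j x) \<le> w j * norm (g j x)" for j x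
    using c by (simp add: mult_right_mono)
  have ae2: "AE x in leb_0_pi. summable (\<lambda>j. norm (c j *\<^sub>R g j x)) \<and> (norm (f x))\<^sup>2 \<le> (\<Sum>j. w j) * G x"
    using ae
  proof eventually_elim
    case (elim x)
    note cs = suminf_weighted_Cauchy_Schwarz[OF w norm_ge_zero elim]
    have s: "summable (\<lambda>j. norm (c j *\<^sub>R g j x))"
      using cle by (intro summable_comparison_test'[OF cs(1)]) auto
    have "norm (f x) \<le> (\<Sum>j. norm (c j *\<^sub>R g j x))" unfolding f_def by (rule summable_norm[OF s])
    also have "\<dots> \<le> (\<Sum>j. w j * norm (g j x))" by (intro suminf_le cle s cs(1))
    finally have "(norm (f x))\<^sup>2 \<le> (\<Sum>j. w j * norm (g j x))\<^sup>2" by (intro power_mono) auto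
    also have "\<dots> \<le> (\<Sum>j. w j) * G x" unfolding G_def by (rule cs(2))
    finally show ?case using s by blast
  qed
  have fm [measurable]: "f \<in> borel_measurable leb_0_pi" unfolding f_def by measurable
  have "integrable leb_0_pi (\<lambda>x. (norm (f x))\<^sup>2)"
  proof (rule Bochner_Integration.integrable_bound)
    show "integrable leb_0_pi (\<lambda>x. (\<Sum>j. w j) * G x)" using G by simp
    show "AE x in leb_0_pi. norm ((norm (f x))\<^sup>2) \<le> norm ((\<Sum>j. w j) * G x)"
      using ae2 by eventually_elim auto
  qed measurable
  then show "f \<in> H_space" using fm by (simp add: H_space_def)
  show "(\<lambda>j. c j *\<^sub>R H_inner (g j) h) sums H_inner f h" if h: "h \<in> H_space"
  proof -
    have cdot_c: "cdot (c j *\<^sub>R u) v = c j *\<^sub>R cdot u v" for j u v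
      by (rule linear_scale[OF bounded_linear.linear[OF bounded_linear_cdot]])
    have int: "integrable leb_0_pi (\<lambda>x. c j *\<^sub>R cdot (g j x) (h x))" for j
      using H_inner_integrable[OF g(1) h] by simp
    have "(\<lambda>j. LINT x|leb_0_pi. c j *\<^sub>R cdot (g j x) (h x)) sums
        (LINT x|leb_0_pi. (\<Sum>j. c j *\<^sub>R cdot (g j x) (h x)))"
    proof (rule sums_integral[OF int])
      show "AE x in leb_0_pi. summable (\<lambda>j. norm (c j *\<^sub>R cdot (g j x) (h x)))"
        using ae2
      proof eventually_elim
        case (elim x)
        then have "summable (\<lambda>j. norm (c j *\<^sub>R g j x) * norm (h x))" by (intro summable_mult2) simp
        then show ?case
        proof (rule summable_comparison_test')
          fix j show "norm (norm (c j *\<^sub>R cdot (g j x) (h x))) \<le> norm (c j *\<^sub>R g j x) * norm (h x)"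
            using norm_cdot_le[of "c j *\<^sub>R g j x" "h x"] by (simp add: cdot_c)
        qed
      qed
      show "summable (\<lambda>j. LINT x|leb_0_pi. norm (c j *\<^sub>R cdot (g j x) (h x)))"
      proof (rule summable_comparison_test'[OF summable_mult2[OF w(2), of "H_norm h"]])
        fix j :: nat
        have "(LINT x|leb_0_pi. norm (cdot (g j x) (h x))) \<le> (LINT x|leb_0_pi. norm (g j x) * norm (h x))"
          by (intro Bochner_Integration.integral_mono integrable_norm H_inner_integrable
              H_norm_product_integral(1) g h norm_cdot_le)
        also have "\<dots> \<le> H_norm h" using H_norm_product_integral(2)[OF g(1) h, of j] g(2) by simp
        finally have "\<bar>c j\<bar> * (LINT x|leb_0_pi. norm (cdot (g j x) (h x))) \<le> w j * H_norm h"
          using c w(1) by (intro mult_mono) auto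
        then show "norm (LINT x|leb_0_pi. norm (c j *\<^sub>R cdot (g j x) (h x))) \<le> w j * H_norm h"
          by (simp add: abs_mult)
      qed
    qed
    moreover have "(LINT x|leb_0_pi. (\<Sum>j. c j *\<^sub>R cdot (g j x) (h x))) = H_inner f h"
      unfolding H_inner_cdot
    proof (rule integral_cong_AE)
      show "AE x in leb_0_pi. (\<Sum>j. c j *\<^sub>R cdot (g j x) (h x)) = cdot (f x) (h x)"
        using ae2
      proof eventually_elim
        case (elim x)
        then have "summable (\<lambda>j. c j *\<^sub>R g j x)" by (blast intro: summable_norm_cancel)
        from bounded_linear.suminf[OF bounded_linear_cdot this, of "h x"]
        show ?case by (simp add: f_def cdot_c)
      qed
      have [measurable]: "h \<in> borel_measurable leb_0_pi" using H_spaceD(1)[OF h] .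
      show "(\<lambda>x. \<Sum>j. c j *\<^sub>R cdot (g j x) (h x)) \<in> borel_measurable leb_0_pi" by measurable
      show "(\<lambda>x. cdot (f x) (h x)) \<in> borel_measurable leb_0_pi" by measurable
    qed
    ultimately show ?thesis unfolding H_inner_cdot by simp
  qed
qed

lemma H_inner_scale_right:
  "H_inner f (\<lambda>x. of_real r *s g x) = of_real r * H_inner f g"
proof -
  have "cdot u (of_real r *s v) = of_real r * cdot u v" for u v
    by (simp add: cdot_def algebra_simps)
  then show ?thesis unfolding H_inner_cdot by simp
qed

text \<open>
  Take \<open>f\<close> as the sum of \<open>(1 / 3) ^ j *\<^sub>R g j\<close> with suitable signs. For each \<open>k\<close> the signs
  make the terms up to \<open>k\<close> contribute at least \<open>(1 / 3) ^ k\<close> to \<open>H_inner f (g k)\<close>, and the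
  remaining terms contribute at most half as much. This is Sokal's elementary route to the
  uniform boundedness principle, without Baire's theorem.
\<close>

lemma gliding_hump:
  assumes g: "\<And>j. g j \<in> H_space" "\<And>j. H_norm (g j) = 1"
  obtains f where "f \<in> H_space" "\<And>k. (1 / 3) ^ k / 2 \<le> norm (H_inner f (g k))"
proof -
  define w :: "nat \<Rightarrow> real" where "w k = (1 / 3) ^ k" for k
  have w0: "0 \<le> w k" for k by (simp add: w_def)
  have wsum: "summable w" unfolding w_def by (simp add: summable_geometric)
  define A where "A j k = w j *\<^sub>R H_inner (g j) (g k)" for j k
  obtain s :: "nat \<Rightarrow> real" where s: "\<And>k. \<bar>s k\<bar> = 1"
    "\<And>k. norm (A k k) \<le> norm (\<Sum>j\<le>k. s j *\<^sub>R A j k)"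
    using exists_signs_diagonal_dominated[of A] by blast
  define f where "f = (\<lambda>x. \<Sum>j. (s j * w j) *\<^sub>R g j x)"
  have c: "\<bar>s j * w j\<bar> \<le> w j" for j using s(1) w0 by (simp add: abs_mult)
  note conv = H_series_converges[of g w "\<lambda>j. s j * w j", OF g w0 wsum c, folded f_def]
  have "(1 / 3) ^ k / 2 \<le> norm (H_inner f (g k))" for k
  proof -
    define b where "b j = (s j * w j) *\<^sub>R H_inner (g j) (g k)" for j
    have bA: "b j = s j *\<^sub>R A j k" for j by (simp add: b_def A_def)
    have bs: "b sums H_inner f (g k)" unfolding b_def by (rule conv(2)[OF g(1)])
    have bw: "norm (b j) \<le> w j" for j
      using H_inner_Cauchy_Schwarz[OF g(1) g(1), of j k] g(2) s(1) w0 mult_left_mono[of "norm (H_inner (g j) (g k))" 1 "w j"]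
      by (simp add: b_def abs_mult)
    have "H_inner (g k) (g k) = 1"
      using g(2)[of k] by (simp add: H_inner_cdot cdot_self H_norm_integral del: of_real_power)
    then have "w k \<le> norm (\<Sum>j<Suc k. b j)"
      using s(2)[of k] w0 unfolding bA lessThan_Suc_atMost by (simp add: A_def)
    moreover have "norm (\<Sum>j. b (j + Suc k)) \<le> w k / 2"
    proof -
      have sw: "(\<lambda>j. w (j + Suc k)) sums (w k / 2)"
        using sums_mult[OF geometric_sums[of "1/3 :: real"], of "w (Suc k)"]
        by (simp add: w_def power_add mult_ac)
      have sb: "summable (\<lambda>j. norm (b (j + Suc k)))"
        using bw by (intro summable_comparison_test'[OF sums_summable[OF sw]]) auto
      have "norm (\<Sum>j. b (j + Suc k)) \<le> (\<Sum>j. norm (b (j + Suc k)))" by (rule summable_norm[OF sb])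
      also have "\<dots> \<le> (\<Sum>j. w (j + Suc k))" by (intro suminf_le bw sb sums_summable[OF sw])
      finally show ?thesis using sums_unique[OF sw] by simp
    qed
    moreover have "H_inner f (g k) = (\<Sum>j. b (j + Suc k)) + (\<Sum>j<Suc k. b j)"
      using suminf_split_initial_segment[OF sums_summable[OF bs], of "Suc k"] sums_unique[OF bs] by simp
    ultimately have "w k - w k / 2 \<le> norm (H_inner f (g k))"
      using norm_diff_ineq[of "\<Sum>j<Suc k. b j" "\<Sum>j. b (j + Suc k)"] by (simp add: add.commute)
    then show ?thesis by (simp add: w_def)
  qed
  with conv(1) show ?thesis using that by blast
qed

text \<open>
  If the products were unbounded, some subsequence would satisfy
  \<open>3 ^ k < H_norm (y (N k)) * H_norm (z (N k))\<close>. The gliding hump along the normalised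
  \<open>z (N k)\<close> gives an \<open>f\<close> whose terms \<open>\<langle>f, z (N k)\<rangle> y (N k)\<close> have norm at least \<open>1 / 2\<close>,
  contradicting that they vanish in the limit.
\<close>

theorem schauder_basis_biorthogonal_norms_bounded:
  assumes basis: "schauder_basis y"
    and z: "\<And>n. z n \<in> H_space"
    and bi: "\<And>n k. H_inner (y n) (z k) = (if n = k then 1 else 0)"
  shows "\<exists>C. \<forall>\<^sub>F n in sequentially. H_norm (y n) * H_norm (z n) \<le> C"
proof (rule ccontr)
  assume "\<not> ?thesis"
  then have "\<forall>k. \<exists>n\<ge>k. 3 ^ k < H_norm (y n) * H_norm (z n)"
    unfolding eventually_sequentially by (meson not_le)
  then obtain N where N: "\<And>k. N k \<ge> k" "\<And>k. 3 ^ k < H_norm (y (N k)) * H_norm (z (N k))"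
    by metis
  have zpos: "H_norm (z (N k)) > 0" for k
  proof (rule ccontr)
    assume "\<not> ?thesis"
    then have "H_norm (z (N k)) = 0" using H_norm_nonneg[of "z (N k)"] by simp
    then have "(3::real) ^ k < 0" using N(2)[of k] by simp
    then show False by simp
  qed
  define g where "g k = (\<lambda>x. of_real (1 / H_norm (z (N k))) *s z (N k) x)" for k
  have gH: "g k \<in> H_space" for k unfolding g_def by (rule H_space_scale[OF z])
  have g1: "H_norm (g k) = 1" for k
    unfolding g_def H_norm_scale using zpos[of k] by (simp add: norm_divide)
  obtain f where f: "f \<in> H_space" "\<And>k. (1 / 3) ^ k / 2 \<le> norm (H_inner f (g k))"
    by (rule gliding_hump[of g, OF gH g1]) (rule that)
  have hump: "norm (H_inner f (g k)) = norm (H_inner f (z (N k))) / H_norm (z (N k))" for k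
  proof -
    have "H_inner f (g k) = of_real (1 / H_norm (z (N k))) * H_inner f (z (N k))"
      unfolding g_def by (rule H_inner_scale_right)
    then show ?thesis using zpos[of k] by (simp add: norm_mult norm_divide)
  qed
  have large: "1 / 2 \<le> norm (H_inner f (z (N k))) * H_norm (y (N k))" for k
  proof -
    have "1 / 2 = (1 / 3) ^ k / 2 * (3 :: real) ^ k" by (simp add: power_one_over)
    also have "\<dots> \<le> norm (H_inner f (g k)) * (H_norm (y (N k)) * H_norm (z (N k)))"
      using f(2)[of k] N(2)[of k] by (intro mult_mono) auto
    also have "\<dots> = norm (H_inner f (z (N k))) * H_norm (y (N k))"
      using zpos[of k] hump[of k] by simp
    finally show ?thesis .
  qed
  have "\<forall>\<^sub>F n in sequentially. norm (H_inner f (z n)) * H_norm (y n) < 1 / 2"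
    using schauder_basis_biorthogonal_terms_vanish[OF basis z bi f(1)]
    by (rule order_tendstoD(2)) simp
  then obtain k where "\<And>n. n \<ge> k \<Longrightarrow> norm (H_inner f (z n)) * H_norm (y n) < 1 / 2"
    unfolding eventually_sequentially by blast
  from this[OF N(1)] large[of k] show False by simp
qed

section \<open>Eigenfunctions of the Dirac operators\<close>

lemma has_vector_derivative_componentwise:
  fixes y :: "real \<Rightarrow> 'a::real_normed_vector ^ 'n"
  assumes "\<And>i. ((\<lambda>t. y t $ i) has_vector_derivative d $ i) (at x)"
  shows "(y has_vector_derivative d) (at x)"
  unfolding has_vector_derivative_def has_derivative_at_within
proof
  show "bounded_linear (\<lambda>h. h *\<^sub>R d)" by (rule bounded_linear_scaleR_left)
  show "((\<lambda>t. (y t - y x - (t - x) *\<^sub>R d) /\<^sub>R norm (t - x)) \<longlongrightarrow> 0) (at x)"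
    using assms unfolding has_vector_derivative_def has_derivative_at_within
    by (intro vec_tendstoI) simp
qed

lemma continuous_integrable_leb_0_pi:
  fixes h :: "real \<Rightarrow> 'a::euclidean_space"
  assumes "continuous_on {0..pi} h"
  shows "integrable leb_0_pi h" and "(LINT x|leb_0_pi. h x) = integral {0..pi} h"
proof -
  have "h absolutely_integrable_on {0<..<pi}"
    using absolutely_integrable_continuous_real[OF assms] absolutely_integrable_on_Icc_iff_Ioo by blast
  then show int: "integrable leb_0_pi h"
    by (intro absolutely_integrable_imp_integrable) auto
  show "(LINT x|leb_0_pi. h x) = integral {0..pi} h"
    using lebesgue_integral_eq_integral[OF int] by (simp add: integral_open_interval_real)
qed

lemma continuous_vec2:
  fixes y :: "real \<Rightarrow> complex^2"
  assumes "\<And>i. continuous_on S (\<lambda>x. y x $ i)"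
  shows "continuous_on S y"
proof -
  have "continuous_on S (\<lambda>x. \<chi> i. y x $ i)" by (intro continuous_intros assms)
  then show ?thesis by simp
qed

lemma dirac_domain_continuous:
  assumes "y \<in> dirac_domain V"
  shows "continuous_on {0..pi} y"
  using assms abs_continuous_on_imp_continuous_on
  by (intro continuous_vec2) (auto simp: dirac_domain_def W11_def)

lemma continuous_H_space:
  assumes "continuous_on {0..pi} (f :: real \<Rightarrow> complex^2)"
  shows "f \<in> H_space"
proof -
  have "continuous_on {0..pi} (\<lambda>x. (norm (f x))\<^sup>2)"
    using assms by (intro continuous_intros)
  then show ?thesis
    using continuous_integrable_leb_0_pi(1)[OF assms] continuous_integrable_leb_0_pi(1)
    by (auto simp: H_space_def)
qed

lemma root_function_dirac_domain:
  assumes "root_function V l y"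
  shows "y \<in> dirac_domain V"
proof -
  obtain m where m: "root_function_of_order V l m y" using assms by (auto simp: root_function_def)
  then show ?thesis by (cases m) (auto simp: eigenfunction_def)
qed

text \<open>
  The eigenvalue equation solved for the derivatives of the components.
\<close>

lemma eigenfunction_dirac_solution:
  assumes "eigenfunction (potential P Q) l y"
  shows "dirac_solution 0 pi (\<i> * l) (\<lambda>x. - \<i> * P x) (\<lambda>x. \<i> * Q x) (\<lambda>x. y x $ 1) (\<lambda>x. y x $ 2)"
proof -
  have W: "(\<lambda>x. y x $ i) \<in> W11" for i
    using assms by (simp add: eigenfunction_def dirac_domain_def)
  have eq: "AE x in leb_0_pi. dirac (potential P Q) y x = l *s y x"
    using assms by (simp add: eigenfunction_def)
  have diff: "AE x in leb_0_pi. (\<lambda>x. y x $ i) differentiable at x" for i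
    using W[of i] by (simp add: W11_def)
  have "AE x in leb_0_pi. dirac (potential P Q) y x = l *s y x
      \<and> (\<lambda>x. y x $ 1) differentiable at x \<and> (\<lambda>x. y x $ 2) differentiable at x"
    using eq diff[of 1] diff[of 2] by eventually_elim blast
  then obtain N where N: "\<And>x. x \<in> {0<..<pi} - N \<Longrightarrow> dirac (potential P Q) y x = l *s y x
      \<and> (\<lambda>x. y x $ 1) differentiable at x \<and> (\<lambda>x. y x $ 2) differentiable at x" "N \<in> null_sets leb_0_pi"
    by (rule AE_E3) auto
  have neg: "negligible (N \<union> {0, pi})"
    using N(2) by (simp add: negligible_iff_null_sets null_sets_restrict_space)
  have "((\<lambda>x. y x $ 1) has_vector_derivative (\<i> * l * y x $ 1 + - \<i> * P x * y x $ 2)) (at x) \<and>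
        ((\<lambda>x. y x $ 2) has_vector_derivative (- (\<i> * l) * y x $ 2 + \<i> * Q x * y x $ 1)) (at x)"
    if x: "x \<in> {0..pi} - (N \<union> {0, pi})" for x
  proof -
    have x': "x \<in> {0<..<pi} - N" using x by auto
    define d where "d = (\<chi> i. vector_derivative (\<lambda>t. y t $ i) (at x))"
    have comp: "((\<lambda>t. y t $ i) has_vector_derivative d $ i) (at x)" for i
      using N(1)[OF x'] exhaust_2[of i] by (auto simp: d_def vector_derivative_works)
    then have "vector_derivative y (at x) = d"
      by (intro vector_derivative_at has_vector_derivative_componentwise)
    then have sys: "B_matrix *v d + potential P Q x *v y x = l *s y x"
      using N(1)[OF x'] by (simp add: dirac_def)
    have e1: "- \<i> * d $ 1 + P x * y x $ 2 = l * y x $ 1"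
      using arg_cong[OF sys, of "\<lambda>v. v $ 1"]
      by (simp add: B_matrix_def potential_def matrix_vector_mult_def sum_2)
    have e2: "\<i> * d $ 2 + Q x * y x $ 1 = l * y x $ 2"
      using arg_cong[OF sys, of "\<lambda>v. v $ 2"]
      by (simp add: B_matrix_def potential_def matrix_vector_mult_def sum_2)
    have "d $ 1 = \<i> * (- \<i> * d $ 1)" by simp
    also have "\<dots> = \<i> * (l * y x $ 1 - P x * y x $ 2)" by (rule arg_cong[OF iffD2[OF eq_diff_eq e1]])
    finally have d1: "d $ 1 = \<i> * l * y x $ 1 + - \<i> * P x * y x $ 2" by (simp add: algebra_simps)
    have "d $ 2 = - \<i> * (\<i> * d $ 2)" by simp
    also have "\<dots> = - \<i> * (l * y x $ 2 - Q x * y x $ 1)" by (rule arg_cong[OF iffD2[OF eq_diff_eq e2]])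
    finally have d2: "d $ 2 = - (\<i> * l) * y x $ 2 + \<i> * Q x * y x $ 1" by (simp add: algebra_simps)
    show ?thesis using comp[of 1] comp[of 2] unfolding d1 d2 by blast
  qed
  then show ?thesis
    unfolding dirac_solution_def using W neg by (auto simp: W11_def intro!: exI[of _ "N \<union> {0, pi}"])
qed

text \<open>
  The adjoint operator has the same form with another potential, so everything proved for
  \<open>potential P Q\<close> applies to it.
\<close>

lemma adj_potential_eq: "adj_potential P Q = potential (\<lambda>x. cnj (Q x)) (\<lambda>x. cnj (P x))"
  by (simp add: adj_potential_def potential_def fun_eq_iff)

text \<open>
  The parameters of the two systems are \<open>\<i> * l\<close> and \<open>\<i> * cnj l\<close>, with real parts \<open>- Im l\<close> and
  \<open>Im l\<close>: conjugating the eigenvalue reverses the growth, as the pairing estimate requires.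
\<close>

theorem eigenfunction_norms_product_large:
  assumes P: "integrable leb_0_pi P" and Q: "integrable leb_0_pi Q"
  shows "\<exists>T. \<forall>l y z. T \<le> \<bar>Im l\<bar> \<longrightarrow> eigenfunction (potential P Q) l y \<longrightarrow>
      eigenfunction (adj_potential P Q) (cnj l) z \<longrightarrow>
      C * norm (H_inner y z) \<le> H_norm y * H_norm z"
proof -
  define q where "q x = norm (P x) + norm (Q x)" for x
  have "integrable leb_0_pi q" unfolding q_def using P Q by auto
  then have "q integrable_on {0<..<pi}" by (rule integrable_on_lebesgue_on) simp
  then have q: "q integrable_on {0..pi}" by (simp add: integrable_on_Icc_iff_Ioo)
  show ?thesis
  proof (rule dirac_solutions_norm_product_large[OF pi_gt_zero q, of C], intro exI allI impI)
    fix T :: real and l :: complex and y z :: "real \<Rightarrow> complex^2"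
    assume T: "\<And>\<mu> \<mu>' \<alpha> \<beta> \<alpha>' \<beta>' f g f' g'.
    \<lbrakk>dirac_solution 0 pi \<mu> \<alpha> \<beta> f g; dirac_solution 0 pi \<mu>' \<alpha>' \<beta>' f' g';
     Re \<mu>' = - Re \<mu>; \<bar>Re \<mu>\<bar> \<ge> T;
     \<And>x. norm (\<alpha> x) \<le> q x; \<And>x. norm (\<beta> x) \<le> q x;
     \<And>x. norm (\<alpha>' x) \<le> q x; \<And>x. norm (\<beta>' x) \<le> q x\<rbrakk> \<Longrightarrow>
    C * norm (integral {0..pi} (\<lambda>x. f x * cnj (f' x) + g x * cnj (g' x)))
    \<le> sqrt (integral {0..pi} (\<lambda>x. (norm (f x))\<^sup>2 + (norm (g x))\<^sup>2))
        * sqrt (integral {0..pi} (\<lambda>x. (norm (f' x))\<^sup>2 + (norm (g' x))\<^sup>2))"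
    assume l: "T \<le> \<bar>Im l\<bar>" and y: "eigenfunction (potential P Q) l y"
      and z: "eigenfunction (adj_potential P Q) (cnj l) z"
    have cy: "continuous_on {0..pi} y" and cz: "continuous_on {0..pi} z"
      using y z dirac_domain_continuous by (auto simp: eigenfunction_def)
    have "H_inner y z = integral {0..pi} (\<lambda>x. y x $ 1 * cnj (z x $ 1) + y x $ 2 * cnj (z x $ 2))"
      unfolding H_inner_def using cy cz
      by (intro continuous_integrable_leb_0_pi(2) continuous_intros)
    moreover have "H_norm f = sqrt (integral {0..pi} (\<lambda>x. (norm (f x $ 1))\<^sup>2 + (norm (f x $ 2))\<^sup>2))"
      if "continuous_on {0..pi} f" for f
      unfolding H_norm_integral norm_complex2_sq using that
      by (subst continuous_integrable_leb_0_pi(2)) (auto intro!: continuous_intros)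
    ultimately show "C * norm (H_inner y z) \<le> H_norm y * H_norm z"
      using T[OF eigenfunction_dirac_solution[OF y] eigenfunction_dirac_solution[OF z[unfolded adj_potential_eq]]] l cy cz
      by (simp add: norm_mult q_def)
  qed
qed

theorem theorem1:
  fixes P Q :: "real \<Rightarrow> complex"
    and y z :: "nat \<Rightarrow> real \<Rightarrow> complex^2"
    and lam :: "nat \<Rightarrow> complex"
  assumes P_L1: "integrable (lebesgue_on {0<..<pi}) P"
    and Q_L1: "integrable (lebesgue_on {0<..<pi}) Q"
    and y_complete: "complete_system y"
    and y_minimal: "minimal_system y"
    and y_root: "\<And>n. root_function (potential P Q) (lam n) (y n)"
    and biorthogonal: "\<And>n k. H_inner (y n) (z k) = (if n = k then 1 else 0)"
    and z_root: "\<And>n. root_function (adj_potential P Q) (cnj (lam n)) (z n)"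
    and finite_assoc: "finite {n. \<not> (eigenfunction (potential P Q) (lam n) (y n) \<and>
                                  eigenfunction (adj_potential P Q) (cnj (lam n)) (z n))}"
    and limsup_Im: "limsup (\<lambda>n. ereal \<bar>Im (lam n)\<bar>) = \<infinity>"
  shows "\<not> schauder_basis y"
proof
  assume basis: "schauder_basis y"
  have zH: "z n \<in> H_space" for n
    using z_root root_function_dirac_domain dirac_domain_continuous continuous_H_space by blast
  obtain C where C: "\<forall>\<^sub>F n in sequentially. H_norm (y n) * H_norm (z n) \<le> C"
    using schauder_basis_biorthogonal_norms_bounded[OF basis zH biorthogonal] by blast
  obtain T where T: "\<forall>l y z. T \<le> \<bar>Im l\<bar> \<longrightarrow> eigenfunction (potential P Q) l y \<longrightarrow>
      eigenfunction (adj_potential P Q) (cnj l) z \<longrightarrow>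
      (C + 1) * norm (H_inner y z) \<le> H_norm y * H_norm z"
    using eigenfunction_norms_product_large[OF P_L1 Q_L1] by blast
  have "\<forall>\<^sub>F n in sequentially. eigenfunction (potential P Q) (lam n) (y n) \<and>
                                  eigenfunction (adj_potential P Q) (cnj (lam n)) (z n)"
    using finite_assoc by (simp add: eventually_cofinite flip: cofinite_eq_sequentially)
  then have "\<forall>\<^sub>F n in sequentially. \<bar>Im (lam n)\<bar> \<le> T"
    using C
  proof eventually_elim
    case (elim n)
    show ?case
    proof (rule ccontr)
      assume "\<not> ?thesis"
      then have "C + 1 \<le> H_norm (y n) * H_norm (z n)"
        using T[rule_format, of "lam n" "y n" "z n"] elim(1) biorthogonal[of n n] by simp
      then show False using elim(2) by simp
    qed
  qed
  then have "limsup (\<lambda>n. ereal \<bar>Im (lam n)\<bar>) \<le> ereal T"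
    by (intro Limsup_bounded) simp
  then show False using limsup_Im by simp
qed
end
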